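(* Let $(S_n)$ be the elephant random walk with memory parameter $p$ in the superdiffusive regime $3/4<p\le1$ and first-step parameter $q\in[0,1]$. Let $L$ be the almost sure limit of $S_n/n^{2p-1}$ and let $V_n=4\sum_{k=1}^{n-1}(S_k/k)^2$. Conditionally on the event $\{L^2>0\}$, $$\sqrt{V_n}\,\bigl(\widehat{p}_n-p\bigr)\longrightarrow\mathcal{N}(0,1)\quad\text{in distribution as }n\to\infty.$$
   Context: Elephant random walk (ERW): fix $q\in[0,1]$ and $p\in[0,1]$. Set $S_0=0$. The first step $X_1$ equals $+1$ with probability $q$ and $-1$ with probability $1-q$. For each $n\ge 1$, an integer $k$ is chosen uniformly at random among $1,\dots,n$ (independently of the past), and $X_{n+1}=X_k$ with probability $p$, $X_{n+1}=-X_k$ with probability $1-p$. The position is $S_{n+1}=S_n+X_{n+1}$, so $S_n=X_1+\cdots+X_n$. Equivalently, with $\mathcal{F}_n=\sigma(X_1,\dots,X_n)$, $\mathbb{P}(X_{n+1}=1\mid\mathcal{F}_n)=\frac12\bigl(1+(2p-1)\frac{S_n}{n}\bigr)$ and $\mathbb{P}(X_{n+1}=-1\mid\mathcal{F}_n)=\frac12\bigl(1-(2p-1)\frac{S_n}{n}\bigr)$ for all $n\ge1$. Estimator: for all $n\ge2$, $$\widehat{p}_n=\frac{\sum_{k=1}^{n-1}\frac{S_k}{k}\bigl(X_{k+1}+\frac{S_k}{k}\bigr)}{2\sum_{k=1}^{n-1}\bigl(\frac{S_k}{k}\bigr)^2}.$$ Known fact used to define $L$: in the superdiffusive regime $3/4<p\le1$,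 $S_n/n^{2p-1}$ converges almost surely to a random variable $L$, which the paper recalls as non-degenerate. "Conditionally on $\{L^2>0\}$" means under the conditional probability given this event.
   Formalization: The endpoint p = 1 is excluded (3/4 < p < 1): for p = 1 all steps equal X_1, so the estimator equals p exactly for n ≥ 2 and sqrt(V_n)(p̂_n − p) = 0 almost surely, which cannot converge to N(0,1). *)

theory Defs
  imports "HOL-Probability.Probability"
begin

text \<open>
  The elephant random walk with memory parameter \<open>p\<close> and first-step parameter \<open>q\<close>.
  \<open>X n\<close> is the \<open>n\<close>-th step for \<open>n \<ge> 1\<close>; the value \<open>X 0\<close> is irrelevant. For \<open>n \<ge> 1\<close>, \<open>\<beta> n\<close> is the
  remembered time and \<open>\<alpha> n\<close> the sign with which that step is repeated at time \<open>n + 1\<close>.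
  The last two conditions together say that \<open>(X 1, \<dots>, X n)\<close>, \<open>\<beta> n\<close> and \<open>\<alpha> n\<close> are mutually
  independent. They are written with \<^const>\<open>prob_space.indep_set\<close> on the generated
  sigma-algebras because \<^const>\<open>prob_space.indep_var\<close> needs equal codomain types.
\<close>

locale elephant_random_walk = prob_space M
  for M :: "'a measure" and p q :: real
    and X :: "nat \<Rightarrow> 'a \<Rightarrow> real" and \<alpha> :: "nat \<Rightarrow> 'a \<Rightarrow> real" and \<beta> :: "nat \<Rightarrow> 'a \<Rightarrow> nat" +
  assumes p_range: "0 \<le> p" "p \<le> 1"
    and q_range: "0 \<le> q" "q \<le> 1"
    and X_measurable: "\<And>n. n \<ge> 1 \<Longrightarrow> random_variable borel (X n)"
    and \<alpha>_measurable: "\<And>n. n \<ge> 1 \<Longrightarrow> random_variable borel (\<alpha> n)"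
    and \<beta>_measurable: "\<And>n. n \<ge> 1 \<Longrightarrow> random_variable (count_space UNIV) (\<beta> n)"
    and first_step:
      "prob {\<omega> \<in> space M. X 1 \<omega> = 1} = q"
      "prob {\<omega> \<in> space M. X 1 \<omega> = -1} = 1 - q"
    and memory_uniform:
      "\<And>n. n \<ge> 1 \<Longrightarrow> distr M (count_space UNIV) (\<beta> n) = measure_pmf (pmf_of_set {1..n})"
    and sign:
      "\<And>n. n \<ge> 1 \<Longrightarrow> prob {\<omega> \<in> space M. \<alpha> n \<omega> = 1} = p"
      "\<And>n. n \<ge> 1 \<Longrightarrow> prob {\<omega> \<in> space M. \<alpha> n \<omega> = -1} = 1 - p"
    and step: "\<And>n. n \<ge> 1 \<Longrightarrow> AE \<omega> in M. X (Suc n) \<omega> = \<alpha> n \<omega> * X (\<beta> n \<omega>) \<omega>"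
    and memory_indep: "\<And>n. n \<ge> 1 \<Longrightarrow> indep_set
      (sets (vimage_algebra (space M) (\<lambda>\<omega>. \<lambda>i\<in>{1..n}. X i \<omega>) (Pi\<^sub>M {1..n} (\<lambda>_. borel))))
      (sets (vimage_algebra (space M) (\<beta> n) (count_space UNIV)))"
    and sign_indep: "\<And>n. n \<ge> 1 \<Longrightarrow> indep_set
      (sets (vimage_algebra (space M) (\<lambda>\<omega>. (\<lambda>i\<in>{1..n}. X i \<omega>, \<beta> n \<omega>))
        (Pi\<^sub>M {1..n} (\<lambda>_. borel) \<Otimes>\<^sub>M count_space UNIV)))
      (sets (vimage_algebra (space M) (\<alpha> n) borel))"

definition erw_position :: "(nat \<Rightarrow> 'a \<Rightarrow> real) \<Rightarrow> nat \<Rightarrow> 'a \<Rightarrow> real" where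
  "erw_position X n \<omega> = (\<Sum>k=1..n. X k \<omega>)"

definition erw_estimator :: "(nat \<Rightarrow> 'a \<Rightarrow> real) \<Rightarrow> nat \<Rightarrow> 'a \<Rightarrow> real" where
  "erw_estimator X n \<omega> =
    (\<Sum>k=1..n-1. erw_position X k \<omega> / real k * (X (k+1) \<omega> + erw_position X k \<omega> / real k))
      / (2 * (\<Sum>k=1..n-1. (erw_position X k \<omega> / real k)\<^sup>2))"

definition erw_V :: "(nat \<Rightarrow> 'a \<Rightarrow> real) \<Rightarrow> nat \<Rightarrow> 'a \<Rightarrow> real" where
  "erw_V X n \<omega> = 4 * (\<Sum>k=1..n-1. (erw_position X k \<omega> / real k)\<^sup>2)"

text \<open>
  For \<open>p = 1\<close> every step equals the first one, so the estimator is exact and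
  \<open>sqrt (V\<^sub>n) * (estimator - p)\<close> vanishes almost surely for all \<open>n \<ge> 2\<close>. Hence no standard
  normal limit holds at that endpoint, whatever \<open>q\<close> is and whatever event one conditions on.
\<close>

lemma (in elephant_random_walk) estimator_exact_at_1:
  assumes "p = 1"
  shows "AE \<omega> in M. \<forall>n\<ge>2. erw_estimator X n \<omega> = p"
proof -
  have X1: "AE \<omega> in M. X 1 \<omega> = 1 \<or> X 1 \<omega> = -1"
  proof -
    have [measurable]: "X (Suc 0) \<in> borel_measurable M" by (rule X_measurable) simp
    have "prob ({\<omega> \<in> space M. X 1 \<omega> = 1} \<union> {\<omega> \<in> space M. X 1 \<omega> = -1})
        = prob {\<omega> \<in> space M. X 1 \<omega> = 1} + prob {\<omega> \<in> space M. X 1 \<omega> = -1}"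
      by (rule finite_measure_Union) auto
    then have "prob ({\<omega> \<in> space M. X 1 \<omega> = 1} \<union> {\<omega> \<in> space M. X 1 \<omega> = -1}) = 1"
      using first_step by simp
    from AE_prob_1[OF this] show ?thesis by eventually_elim auto
  qed
  have "AE \<omega> in M. X (Suc n) \<omega> = X (\<beta> n \<omega>) \<omega> \<and> \<beta> n \<omega> \<in> {1..n}" if n: "n \<ge> 1" for n
  proof -
    have "AE \<omega> in M. \<alpha> n \<omega> = 1"
      using AE_prob_1[of "{\<omega> \<in> space M. \<alpha> n \<omega> = 1}"] sign(1)[OF n] assms by auto
    moreover have "AE \<omega> in M. \<beta> n \<omega> \<in> {1..n}"
    proof -
      have "AE k in measure_pmf (pmf_of_set {1..n}). k \<in> {1..n}"
        using n by (simp add: AE_measure_pmf_iff)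
      then have "AE k in distr M (count_space UNIV) (\<beta> n). k \<in> {1..n}"
        unfolding memory_uniform[OF n] .
      then show ?thesis
        using \<beta>_measurable[OF n] by (simp add: AE_distr_iff)
    qed
    ultimately show ?thesis
      using step[OF n] by eventually_elim simp
  qed
  then have "AE \<omega> in M. \<forall>n\<ge>1. X (Suc n) \<omega> = X (\<beta> n \<omega>) \<omega> \<and> \<beta> n \<omega> \<in> {1..n}"
    by (simp add: AE_all_countable)
  with X1 show ?thesis
  proof eventually_elim
    case (elim \<omega>)
    have const: "k \<ge> 1 \<Longrightarrow> X k \<omega> = X 1 \<omega>" for k
    proof (induction k rule: less_induct)
      case (less k)
      show ?case
      proof (cases "k = 1")
        case False
        with less.prems obtain m where m: "k = Suc m" "m \<ge> 1" by (cases k) auto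
        with elim have "X k \<omega> = X (\<beta> m \<omega>) \<omega>" "\<beta> m \<omega> \<in> {1..m}" by auto
        with less.IH[of "\<beta> m \<omega>"] m show ?thesis by auto
      qed simp
    qed
    have S: "erw_position X k \<omega> / real k = X 1 \<omega>" if "k \<ge> 1" for k
    proof -
      have "(\<Sum>j=1..k. X j \<omega>) = (\<Sum>j=1..k. X 1 \<omega>)"
        by (rule sum.cong[OF refl], rule const) simp
      then show ?thesis using that by (simp add: erw_position_def)
    qed
    have sq: "X 1 \<omega> * X 1 \<omega> = 1" using elim(1) by auto
    show ?case
    proof (intro allI impI)
      fix n :: nat assume n: "n \<ge> 2"
      have "(\<Sum>k=1..n-1. erw_position X k \<omega> / real k *
          (X (k+1) \<omega> + erw_position X k \<omega> / real k)) = (\<Sum>k=1..n-1. 2)"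
      proof (rule sum.cong[OF refl])
        fix k assume "k \<in> {1..n-1}"
        then have k: "k \<ge> 1" by simp
        have "X (k+1) \<omega> = X 1 \<omega>" by (rule const) simp
        then show "erw_position X k \<omega> / real k *
            (X (k+1) \<omega> + erw_position X k \<omega> / real k) = 2"
          unfolding S[OF k] using sq by (simp add: distrib_left)
      qed
      moreover have "(\<Sum>k=1..n-1. (erw_position X k \<omega> / real k)\<^sup>2) = (\<Sum>k=1..n-1. 1)"
      proof (rule sum.cong[OF refl])
        fix k assume "k \<in> {1..n-1}"
        then have k: "k \<ge> 1" by simp
        show "(erw_position X k \<omega> / real k)\<^sup>2 = 1"
          unfolding S[OF k] power2_eq_square by (rule sq)
      qed
      ultimately show "erw_estimator X n \<omega> = p"
        using n assms by (simp add: erw_estimator_def)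
    qed
  qed
qed

lemma (in elephant_random_walk) no_normal_limit_at_1:
  assumes "p = 1" and A: "A \<in> events"
  shows "\<not> weak_conv_m
    (\<lambda>n. distr (uniform_measure M A) borel
      (\<lambda>\<omega>. sqrt (erw_V X n \<omega>) * (erw_estimator X n \<omega> - p)))
    std_normal_distribution"
proof
  define T where "T = (\<lambda>n \<omega>. sqrt (erw_V X n \<omega>) * (erw_estimator X n \<omega> - p))"
  assume "weak_conv_m
    (\<lambda>n. distr (uniform_measure M A) borel
      (\<lambda>\<omega>. sqrt (erw_V X n \<omega>) * (erw_estimator X n \<omega> - p)))
    std_normal_distribution"
  then have conv: "weak_conv (\<lambda>n. cdf (distr (uniform_measure M A) borel (T n)))
      (cdf std_normal_distribution)"
    by (simp add: weak_conv_m_def T_def)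
  interpret N: real_distribution std_normal_distribution
    by (rule real_dist_normal_dist)
  have null: "emeasure std_normal_distribution {-1} = 0"
    by (subst emeasure_density) (auto simp: nn_integral_indicator_singleton')
  have lim: "(\<lambda>n. cdf (distr (uniform_measure M A) borel (T n)) (-1))
      \<longlonglongrightarrow> cdf std_normal_distribution (-1)"
    using conv null by (auto simp: weak_conv_def N.isCont_cdf N.emeasure_eq_measure)
  have "cdf (distr (uniform_measure M A) borel (T n)) (-1) = 0" if n: "n \<ge> 2" for n
  proof -
    have [measurable]: "X k \<in> borel_measurable M" if "k \<ge> 1" for k
      using X_measurable[OF that] by simp
    have S[measurable]: "erw_position X k \<in> borel_measurable M" for k
      unfolding erw_position_def[abs_def] by measurable
    have T[measurable]: "T n \<in> borel_measurable M"
      unfolding T_def erw_V_def erw_estimator_def by measurable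
    have "AE \<omega> in M. \<not> T n \<omega> \<le> -1"
      using estimator_exact_at_1[OF assms(1)] by eventually_elim (use n in \<open>simp add: T_def\<close>)
    then have "AE \<omega> in uniform_measure M A. \<not> T n \<omega> \<le> -1"
      by (intro AE_uniform_measureI A) auto
    then have "emeasure (uniform_measure M A) {\<omega> \<in> space M. T n \<omega> \<le> -1} = 0"
      by (subst (asm) AE_iff_measurable[OF _ refl]) simp_all
    moreover have "T n -` {..-1} \<inter> space M = {\<omega> \<in> space M. T n \<omega> \<le> -1}" by auto
    ultimately show ?thesis
      by (simp add: cdf_def measure_def emeasure_distr)
  qed
  then have "eventually (\<lambda>n. cdf (distr (uniform_measure M A) borel (T n)) (-1) = 0) sequentially"
    by (auto simp: eventually_sequentially)
  then have "(\<lambda>n. cdf (distr (uniform_measure M A) borel (T n)) (-1)) \<longlonglongrightarrow> 0"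
    by (rule tendsto_eventually)
  with lim have "cdf std_normal_distribution (-1) = 0"
    using LIMSEQ_unique by blast
  then have "emeasure std_normal_distribution {..-1} = 0"
    by (simp add: cdf_def N.emeasure_eq_measure)
  then have "AE x in std_normal_distribution. x \<notin> {..-1}"
    by (intro AE_I'[of "{..-1}"]) (auto simp: null_sets_def)
  then have "AE x in lborel. \<not> x \<le> (-1::real)"
    by (subst (asm) AE_density) (simp_all add: normal_density_pos)
  then have "emeasure lborel {..-1::real} = 0"
    by (subst (asm) AE_iff_measurable[OF _ refl]) (simp_all add: atMost_def)
  moreover have "emeasure lborel {-2..-1::real} \<le> emeasure lborel {..-1::real}"
    by (rule emeasure_mono) auto
  ultimately show False by simp
qed

end

theory Submission
  imports Defs
begin

text \<open>
  Write \<open>a = 2p - 1\<close> and \<open>\<epsilon>\<^sub>k = X\<^sub>k\<^sub>+\<^sub>1 - a S\<^sub>k / k\<close>, which are bounded martingale differences. Then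
  \<open>sqrt V\<^sub>n (estimator - p)\<close> equals the self-normalized martingale
  \<open>(\<Sum>k<n. (S\<^sub>k / k) \<epsilon>\<^sub>k) / sqrt (\<Sum>k<n. (S\<^sub>k / k)\<^sup>2)\<close>, where \<open>S\<^sub>k / k \<approx> L k\<^sup>a\<^sup>-\<^sup>1\<close>. Its random normalization
  is proportional to \<open>\<bar>L\<bar>\<close> in the limit and is replaced by \<open>\<bar>S\<^sub>m / m\<^sup>a\<bar>\<close> for a slowly growing time
  \<open>m = m(n)\<close>, summing only over \<open>k \<ge> m\<close>; after clamping the ratios of \<open>S\<^sub>k / k\<^sup>a\<close> to this quantity,
  the summands \<open>x\<^sub>k\<close> are predictable multiples of \<open>\<epsilon>\<^sub>k\<close>, uniformly small, and \<open>\<Sum>x\<^sub>k\<^sup>2\<close> is bounded.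
  McLeish's product \<open>\<Prod>k. 1 + i t x\<^sub>k\<close> then has conditional mean one given the first \<open>m\<close> steps. On
  \<open>{L \<noteq> 0}\<close> it is asymptotic to \<open>exp (i t \<Sum>x\<^sub>k + t\<^sup>2 / 2)\<close>: the quadratic variation converges almost
  surely because \<open>\<epsilon>\<^sub>k\<^sup>2 \<rightarrow> 1\<close>, as \<open>X\<^sub>k\<^sub>+\<^sub>1\<^sup>2 = 1\<close> and \<open>S\<^sub>k / k \<rightarrow> 0\<close>. Testing against continuous functions of
  \<open>S\<^sub>m / m\<^sup>a\<close> that vanish at \<open>0\<close> gives the limit of the characteristic functions on \<open>{L \<noteq> 0}\<close>. This event is not
  null: \<open>E[X\<^sub>1 S\<^sub>n] \<ge> n\<^sup>a\<close> while \<open>S\<^sub>n / n\<^sup>a\<close> is bounded in \<open>L\<^sup>2\<close>, hence uniformly integrable.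
\<close>

subsection \<open>McLeish's product expansion\<close>

text \<open>The product of \<open>1 - y + y\<^sup>2 / 2\<close> and
  \<open>1 + y + y\<^sup>2 / 2\<close> is \<open>1 + y ^ 4 / 4\<close>, hence at least one, and the
  second factor is at most \<open>exp y\<close>.\<close>

lemma exp_minus_le_quadratic: "exp (- y) \<le> 1 - y + y\<^sup>2 / 2" if "0 \<le> y" for y :: real
proof -
  have "1 + y + y\<^sup>2 / 2 \<le> exp y" using exp_lower_Taylor_quadratic[OF that] .
  have pos: "0 \<le> 1 - y + y\<^sup>2 / 2"
    using zero_le_power2[of "y - 1"] unfolding power2_diff by simp
  have "1 \<le> 1 + (y\<^sup>2)\<^sup>2 / 4" by simp
  also have "\<dots> = (1 - y + y\<^sup>2 / 2) * (1 + y + y\<^sup>2 / 2)"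
    by (simp add: algebra_simps power2_eq_square)
  also have "\<dots> \<le> (1 - y + y\<^sup>2 / 2) * exp y"
    using pos exp_lower_Taylor_quadratic[OF that] by (rule mult_left_mono[rotated])
  finally show ?thesis by (simp add: exp_minus field_simps)
qed

text \<open>The squared modulus \<open>1 + x\<^sup>2\<close> is at most
  \<open>exp (x\<^sup>2)\<close>. This makes McLeish's product bounded as soon as the sum of squares
  is.\<close>

lemma cmod_1_plus_ii_le: "cmod (1 + \<i> * complex_of_real x) \<le> exp (x\<^sup>2 / 2)"
proof -
  have "(cmod (1 + \<i> * complex_of_real x))\<^sup>2 = 1 + x\<^sup>2" by (simp add: cmod_power2)
  also have "\<dots> \<le> exp (x\<^sup>2)" by (rule exp_ge_add_one_self)
  also have "\<dots> = (exp (x\<^sup>2 / 2))\<^sup>2" by (simp add: power2_eq_square flip: exp_add)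
  finally show ?thesis by (rule power2_le_imp_le) simp
qed

text \<open>Both terms agree with \<open>1 + \<i> * x - x\<^sup>2 / 2\<close> up to third order. The
  error splits into the Taylor remainder of \<open>iexp\<close>, the cubic term of
  \<open>(1 + \<i> * x) * (1 - x\<^sup>2 / 2)\<close> and the remainder \<open>r\<close> of the
  Gaussian factor; their coefficients 1/6, 1/2 and 1/4 add up to less than one.\<close>

lemma cmod_iexp_minus_McLeish_factor:
  assumes "\<bar>x\<bar> \<le> 1"
  shows "cmod (iexp x - (1 + \<i> * x) * complex_of_real (exp (- x\<^sup>2 / 2))) \<le> \<bar>x\<bar> ^ 3"
proof -
  define r where "r = exp (- (x\<^sup>2 / 2)) - (1 - x\<^sup>2 / 2)"
  have r0: "0 \<le> r" using exp_ge_add_one_self[of "- (x\<^sup>2 / 2)"] by (simp add: r_def)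
  have "r \<le> (x\<^sup>2 / 2)\<^sup>2 / 2" using exp_minus_le_quadratic[of "x\<^sup>2 / 2"] by (simp add: r_def)
  also have "\<dots> = \<bar>x\<bar> ^ 3 * \<bar>x\<bar> / 8" by (simp add: power_divide power2_eq_square power3_eq_cube)
  also have "\<dots> \<le> \<bar>x\<bar> ^ 3 * 1 / 8"
    by (intro divide_right_mono mult_left_mono assms) auto
  finally have r1: "r \<le> \<bar>x\<bar> ^ 3 / 8" by simp
  have e: "(\<Sum>k\<le>2. (\<i> * complex_of_real x) ^ k / fact k) = 1 + \<i> * x - x\<^sup>2 / 2"
    by (simp add: numeral_2_eq_2 power_mult_distrib)
  have t1: "cmod (iexp x - (1 + \<i> * x - x\<^sup>2 / 2)) \<le> \<bar>x\<bar> ^ 3 / 6"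
    using iexp_approx1[of x 2] unfolding e by (simp add: numeral_3_eq_3 fact_numeral)
  have t2: "cmod (\<i> * complex_of_real (x ^ 3) / 2) = \<bar>x\<bar> ^ 3 / 2"
    by (simp add: norm_mult norm_divide norm_power)
  have "cmod (1 + \<i> * complex_of_real x) \<le> 1 + \<bar>x\<bar>"
    using norm_triangle_ineq[of 1 "\<i> * complex_of_real x"] by (simp add: norm_mult)
  then have "cmod (1 + \<i> * complex_of_real x) * r \<le> 2 * (\<bar>x\<bar> ^ 3 / 8)"
    using assms r0 r1 by (intro mult_mono) auto
  then have t3: "cmod ((1 + \<i> * complex_of_real x) * r) \<le> \<bar>x\<bar> ^ 3 / 4"
    using r0 by (simp add: norm_mult)
  have eq: "iexp x - (1 + \<i> * x) * complex_of_real (exp (- x\<^sup>2 / 2)) =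
      (iexp x - (1 + \<i> * x - x\<^sup>2 / 2)) + (\<i> * complex_of_real (x ^ 3) / 2) - (1 + \<i> * complex_of_real x) * r"
    unfolding r_def by (simp add: field_simps power2_eq_square power3_eq_cube)
  have "cmod (iexp x - (1 + \<i> * x) * complex_of_real (exp (- x\<^sup>2 / 2))) \<le> \<bar>x\<bar> ^ 3 / 6 + \<bar>x\<bar> ^ 3 / 2 + \<bar>x\<bar> ^ 3 / 4"
    unfolding eq using t1 t2 t3
    by (smt (verit) norm_triangle_ineq norm_triangle_ineq4)
  also have "\<dots> \<le> \<bar>x\<bar> ^ 3" by simp
  finally show ?thesis .
qed

lemma cmod_prod_1_plus_ii_le:
  "cmod (\<Prod>i\<in>I. 1 + \<i> * complex_of_real (x i)) \<le> exp ((\<Sum>i\<in>I. (x i)\<^sup>2) / 2)"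
proof (cases "finite I")
  case True
  have "cmod (\<Prod>i\<in>I. 1 + \<i> * complex_of_real (x i)) \<le> (\<Prod>i\<in>I. exp ((x i)\<^sup>2 / 2))"
    unfolding prod_norm[symmetric] by (intro prod_mono conjI cmod_1_plus_ii_le norm_ge_zero)
  also have "\<dots> = exp ((\<Sum>i\<in>I. (x i)\<^sup>2) / 2)"
    using True by (simp add: exp_sum sum_divide_distrib)
  finally show ?thesis .
qed simp

text \<open>Both terms are products of factors of modulus at most one, so their distance is at most
  the sum of the distances of the factors.\<close>

lemma McLeish_expansion:
  assumes "finite I" and "\<And>i. i \<in> I \<Longrightarrow> \<bar>x i\<bar> \<le> 1"
  shows "cmod (iexp (\<Sum>i\<in>I. x i) - (\<Prod>i\<in>I. 1 + \<i> * complex_of_real (x i)) * complex_of_real (exp (- (\<Sum>i\<in>I. (x i)\<^sup>2) / 2)))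
    \<le> (\<Sum>i\<in>I. \<bar>x i\<bar> ^ 3)"
proof -
  have 1: "iexp (\<Sum>i\<in>I. x i) = (\<Prod>i\<in>I. iexp (x i))"
    using assms(1) by (simp add: exp_sum sum_distrib_left)
  have 2: "(\<Prod>i\<in>I. 1 + \<i> * complex_of_real (x i)) * complex_of_real (exp (- (\<Sum>i\<in>I. (x i)\<^sup>2) / 2))
      = (\<Prod>i\<in>I. (1 + \<i> * complex_of_real (x i)) * complex_of_real (exp (- (x i)\<^sup>2 / 2)))"
    using assms(1) by (simp add: prod.distrib exp_sum sum_divide_distrib flip: sum_negf)
  have 3: "cmod ((1 + \<i> * complex_of_real y) * complex_of_real (exp (- y\<^sup>2 / 2))) \<le> 1" for y :: real
    using mult_right_mono[OF cmod_1_plus_ii_le[of y], of "exp (- y\<^sup>2 / 2)"]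
    by (simp add: norm_mult flip: exp_add)
  show ?thesis
    unfolding 1 2
    by (rule order_trans[OF norm_prod_diff sum_mono])
       (use assms(2) 3 cmod_iexp_minus_McLeish_factor in auto)
qed

subsection \<open>Weighted averages and normalizations\<close>

text \<open>A Toeplitz argument: the indices below \<open>m n\<close> carry a vanishing share of the
  weight, and on the rest \<open>u\<close> is uniformly close to \<open>c\<close>.\<close>

lemma weighted_average_tendsto:
  fixes w :: "nat \<Rightarrow> real" and u :: "nat \<Rightarrow> nat \<Rightarrow> real" and m :: "nat \<Rightarrow> nat"
  assumes w: "\<And>k. 0 \<le> w k"
    and pos: "\<forall>\<^sub>F n in sequentially. 0 < (\<Sum>k=1..<n. w k)"
    and m: "\<forall>\<^sub>F n in sequentially. 1 \<le> m n \<and> m n \<le> n"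
    and head: "(\<lambda>n. (\<Sum>k=1..<m n. w k) / (\<Sum>k=1..<n. w k)) \<longlonglongrightarrow> 0"
    and u: "\<And>e. 0 < e \<Longrightarrow> \<forall>\<^sub>F n in sequentially. \<forall>k\<in>{m n..<n}. \<bar>u n k - c\<bar> \<le> e"
  shows "(\<lambda>n. (\<Sum>k=m n..<n. u n k * w k) / (\<Sum>k=1..<n. w k)) \<longlonglongrightarrow> c"
proof (rule Lim_transform2)
  let ?B = "\<lambda>n. \<Sum>k=1..<n. w k"
  \<comment> \<open>The comparison sequence is \<open>c\<close> times the share of the weight
    carried by the window \<open>{m n..<n}\<close>.\<close>
  show "(\<lambda>n. c - c * ((\<Sum>k=1..<m n. w k) / ?B n)) \<longlonglongrightarrow> c"
    using tendsto_diff[OF tendsto_const[of c] tendsto_mult_left_zero[OF head, of c]]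
    by (simp add: mult.commute)
  show "(\<lambda>n. (c - c * ((\<Sum>k=1..<m n. w k) / ?B n)) - (\<Sum>k=m n..<n. u n k * w k) / ?B n) \<longlonglongrightarrow> 0"
  proof (rule LIMSEQ_I)
    fix r :: real assume r: "0 < r"
    have "\<forall>\<^sub>F n in sequentially. norm ((c - c * ((\<Sum>k=1..<m n. w k) / ?B n)) - (\<Sum>k=m n..<n. u n k * w k) / ?B n) < r"
      using pos m u[OF half_gt_zero[OF r]]
    proof eventually_elim
      case (elim n)
      have el: "\<forall>k\<in>{m n..<n}. \<bar>u n k - c\<bar> \<le> r / 2" using elim r by simp
      have split: "?B n = (\<Sum>k=1..<m n. w k) + (\<Sum>k=m n..<n. w k)"
        using elim by (simp add: sum.atLeastLessThan_concat)
      have "(c - c * ((\<Sum>k=1..<m n. w k) / ?B n)) - (\<Sum>k=m n..<n. u n k * w k) / ?B n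
          = (c * (?B n - (\<Sum>k=1..<m n. w k)) - (\<Sum>k=m n..<n. u n k * w k)) / ?B n"
        using elim(1) by (simp add: field_simps)
      also have "\<dots> = (\<Sum>k=m n..<n. (c - u n k) * w k) / ?B n"
        unfolding split by (simp add: sum_distrib_left left_diff_distrib sum_subtractf)
      finally have "norm ((c - c * ((\<Sum>k=1..<m n. w k) / ?B n)) - (\<Sum>k=m n..<n. u n k * w k) / ?B n)
          = \<bar>\<Sum>k=m n..<n. (c - u n k) * w k\<bar> / ?B n"
        using elim(1) by (simp add: abs_divide)
      also have "\<bar>\<Sum>k=m n..<n. (c - u n k) * w k\<bar> \<le> (\<Sum>k=m n..<n. r / 2 * w k)"
      proof (rule order_trans[OF sum_abs sum_mono])
        fix k assume "k \<in> {m n..<n}"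
        then have "\<bar>c - u n k\<bar> \<le> r / 2" using el by (simp add: abs_minus_commute)
        then show "\<bar>(c - u n k) * w k\<bar> \<le> r / 2 * w k"
          unfolding abs_mult abs_of_nonneg[OF w] by (rule mult_right_mono) (rule w)
      qed
      also have "\<dots> \<le> r / 2 * ?B n"
        unfolding split sum_distrib_left[symmetric] using r w
        by (intro mult_left_mono) (auto intro: sum_nonneg)
      also have "r / 2 * ?B n / ?B n < r" using elim(1) r by simp
      finally show ?case using elim(1) by (simp add: divide_right_mono)
    qed
    then show "\<exists>no. \<forall>n\<ge>no. norm ((c - c * ((\<Sum>k=1..<m n. w k) / ?B n)) - (\<Sum>k=m n..<n. u n k * w k) / ?B n - 0) < r"
      by (simp add: eventually_sequentially)
  qed
qed

section \<open>Slutsky's theorem for characteristic functions\<close>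

lemma cmod_iexp_diff_le: "cmod (iexp x - iexp y) \<le> \<bar>x - y\<bar>"
proof -
  have "iexp x - iexp y = iexp y * (iexp (x - y) - 1)"
    by (simp add: algebra_simps flip: exp_add)
  then have "cmod (iexp x - iexp y) = cmod (iexp (x - y) - 1)"
    by (simp add: norm_mult)
  also have "\<dots> \<le> \<bar>x - y\<bar>" using iexp_approx1[of "x - y" 0] by simp
  finally show ?thesis .
qed

text \<open>This exchanges one normalization for another under the integral. As \<open>N\<close> is
  bounded in L^2, Young's inequality splits \<open>N n * \<eta> n\<close> into a term of small mean
  and one that vanishes along paths with \<open>g \<noteq> 0\<close>; dominated convergence handles
  the latter.\<close>

lemma (in prob_space) iexp_Slutsky:
  fixes N U \<eta> \<rho> :: "nat \<Rightarrow> 'a \<Rightarrow> real" and g :: "'a \<Rightarrow> real"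
  assumes [measurable]: "\<And>n. N n \<in> borel_measurable M" "\<And>n. U n \<in> borel_measurable M"
      "\<And>n. \<eta> n \<in> borel_measurable M" "\<And>n. \<rho> n \<in> borel_measurable M" "g \<in> borel_measurable M"
    and g: "\<And>\<omega>. 0 \<le> g \<omega>" "\<And>\<omega>. g \<omega> \<le> 1"
    and int: "\<And>n. integrable M (\<lambda>\<omega>. (N n \<omega>)\<^sup>2)" and C: "\<And>n. (\<integral>\<omega>. (N n \<omega>)\<^sup>2 \<partial>M) \<le> C"
    and eq: "\<And>n \<omega>. U n \<omega> - N n \<omega> = N n \<omega> * \<eta> n \<omega> + \<rho> n \<omega>"
    and lim: "AE \<omega> in M. g \<omega> \<noteq> 0 \<longrightarrow> (\<lambda>n. \<eta> n \<omega>) \<longlonglongrightarrow> 0 \<and> (\<lambda>n. \<rho> n \<omega>) \<longlonglongrightarrow> 0"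
  shows "(\<lambda>n. \<integral>\<omega>. g \<omega> * cmod (iexp (U n \<omega>) - iexp (N n \<omega>)) \<partial>M) \<longlonglongrightarrow> 0"
proof (rule LIMSEQ_I)
  fix r :: real assume r: "0 < r"
  have "0 \<le> (\<integral>\<omega>. (N 0 \<omega>)\<^sup>2 \<partial>M)" by (rule integral_nonneg_AE) simp
  then have C0: "0 \<le> C" using C[of 0] by linarith
  \<comment> \<open>The weight in Young's inequality, chosen so that
    \<open>l * (C + 1) = r / 2\<close>; the added one keeps the denominator positive when
    \<open>C = 0\<close>.\<close>
  define l where "l = r / (2 * (C + 1))"
  have l: "0 < l" using r C0 by (simp add: l_def)
  \<comment> \<open>The cap 2 is the trivial bound for the distance of two points of the unit
    circle; it supplies the dominating function.\<close>
  define h where "h n \<omega> = g \<omega> * min 2 ((\<eta> n \<omega>)\<^sup>2 / l + \<bar>\<rho> n \<omega>\<bar>)" for n \<omega>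
  have [measurable]: "h n \<in> borel_measurable M" for n unfolding h_def[abs_def] by measurable
  have h_bd: "\<bar>h n \<omega>\<bar> \<le> 2" for n \<omega>
  proof -
    have "0 \<le> min 2 ((\<eta> n \<omega>)\<^sup>2 / l + \<bar>\<rho> n \<omega>\<bar>)" using l by simp
    then have "\<bar>h n \<omega>\<bar> \<le> 1 * 2" unfolding h_def abs_mult using g by (intro mult_mono) auto
    then show ?thesis by simp
  qed
  have h_int: "integrable M (h n)" for n by (rule integrable_const_bound[of _ 2]) (auto simp: h_bd)
  have "(\<lambda>n. \<integral>\<omega>. h n \<omega> \<partial>M) \<longlonglongrightarrow> (\<integral>\<omega>. 0 \<partial>M)"
  proof (rule integral_dominated_convergence[where w = "\<lambda>_. 2"])
    show "AE \<omega> in M. (\<lambda>n. h n \<omega>) \<longlonglongrightarrow> 0"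
      using lim
    proof eventually_elim
      case (elim \<omega>)
      show ?case
      proof (cases "g \<omega> = 0")
        case False
        with elim have "(\<lambda>n. \<eta> n \<omega>) \<longlonglongrightarrow> 0" "(\<lambda>n. \<rho> n \<omega>) \<longlonglongrightarrow> 0" by auto
        then have "(\<lambda>n. h n \<omega>) \<longlonglongrightarrow> g \<omega> * min 2 (0\<^sup>2 / l + \<bar>0\<bar>)"
          unfolding h_def by (intro tendsto_intros) (use l in auto)
        then show ?thesis by simp
      qed (simp add: h_def)
    qed
  qed (auto simp: h_bd)
  then have "\<forall>\<^sub>F n in sequentially. (\<integral>\<omega>. h n \<omega> \<partial>M) < r / 2"
    using r by (intro order_tendstoD(2)[where y=0]) auto
  moreover have "(\<integral>\<omega>. g \<omega> * cmod (iexp (U n \<omega>) - iexp (N n \<omega>)) \<partial>M) \<le> r / 2 + (\<integral>\<omega>. h n \<omega> \<partial>M)" for n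
  proof -
    have "(\<integral>\<omega>. g \<omega> * cmod (iexp (U n \<omega>) - iexp (N n \<omega>)) \<partial>M) \<le> (\<integral>\<omega>. l * (N n \<omega>)\<^sup>2 + h n \<omega> \<partial>M)"
    proof (rule integral_mono')
      show "integrable M (\<lambda>\<omega>. l * (N n \<omega>)\<^sup>2 + h n \<omega>)" using int h_int by simp
      fix \<omega>
      have le2: "cmod (iexp (U n \<omega>) - iexp (N n \<omega>)) \<le> 2"
        using norm_triangle_ineq4[of "iexp (U n \<omega>)" "iexp (N n \<omega>)"] by simp
      have "cmod (iexp (U n \<omega>) - iexp (N n \<omega>)) \<le> \<bar>N n \<omega> * \<eta> n \<omega> + \<rho> n \<omega>\<bar>"
        using cmod_iexp_diff_le[of "U n \<omega>" "N n \<omega>"] unfolding eq .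
      also have "\<dots> \<le> \<bar>N n \<omega> * \<eta> n \<omega>\<bar> + \<bar>\<rho> n \<omega>\<bar>" by (rule abs_triangle_ineq)
      \<comment> \<open>Young's inequality: expand a square, drop a factor 2 in front of the cross
        term, and divide by \<open>l\<close>.\<close>
      also have "\<bar>N n \<omega> * \<eta> n \<omega>\<bar> \<le> l * (N n \<omega>)\<^sup>2 + (\<eta> n \<omega>)\<^sup>2 / l"
      proof -
        have "0 \<le> (l * \<bar>N n \<omega>\<bar> - \<bar>\<eta> n \<omega>\<bar>)\<^sup>2" by simp
        also have "\<dots> = l\<^sup>2 * (N n \<omega>)\<^sup>2 + (\<eta> n \<omega>)\<^sup>2 - 2 * l * \<bar>N n \<omega> * \<eta> n \<omega>\<bar>"
          by (simp add: power2_diff power_mult_distrib abs_mult)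
        finally have "2 * l * \<bar>N n \<omega> * \<eta> n \<omega>\<bar> \<le> l\<^sup>2 * (N n \<omega>)\<^sup>2 + (\<eta> n \<omega>)\<^sup>2" by simp
        moreover have "l * \<bar>N n \<omega> * \<eta> n \<omega>\<bar> \<ge> 0" using l by simp
        ultimately have "l * \<bar>N n \<omega> * \<eta> n \<omega>\<bar> \<le> l\<^sup>2 * (N n \<omega>)\<^sup>2 + (\<eta> n \<omega>)\<^sup>2" by linarith
        also have "\<dots> = l * (l * (N n \<omega>)\<^sup>2 + (\<eta> n \<omega>)\<^sup>2 / l)"
          using l by (simp add: field_simps power2_eq_square)
        finally show ?thesis using l by simp
      qed
      finally have le: "cmod (iexp (U n \<omega>) - iexp (N n \<omega>)) \<le> l * (N n \<omega>)\<^sup>2 + (\<eta> n \<omega>)\<^sup>2 / l + \<bar>\<rho> n \<omega>\<bar>"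
        by simp
      have nn: "0 \<le> l * (N n \<omega>)\<^sup>2" using l by simp
      have "cmod (iexp (U n \<omega>) - iexp (N n \<omega>)) - l * (N n \<omega>)\<^sup>2 \<le> min 2 ((\<eta> n \<omega>)\<^sup>2 / l + \<bar>\<rho> n \<omega>\<bar>)"
        using le le2 nn by (intro min.boundedI; linarith)
      then have "cmod (iexp (U n \<omega>) - iexp (N n \<omega>)) \<le> l * (N n \<omega>)\<^sup>2 + min 2 ((\<eta> n \<omega>)\<^sup>2 / l + \<bar>\<rho> n \<omega>\<bar>)"
        by linarith
      then have "g \<omega> * cmod (iexp (U n \<omega>) - iexp (N n \<omega>)) \<le> g \<omega> * (l * (N n \<omega>)\<^sup>2) + h n \<omega>"
        using mult_left_mono[OF _ g(1)[of \<omega>]] unfolding h_def by (metis distrib_left)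
      moreover have "g \<omega> * (l * (N n \<omega>)\<^sup>2) \<le> 1 * (l * (N n \<omega>)\<^sup>2)"
        using g l by (intro mult_right_mono) auto
      ultimately show *: "g \<omega> * cmod (iexp (U n \<omega>) - iexp (N n \<omega>)) \<le> l * (N n \<omega>)\<^sup>2 + h n \<omega>" by simp
      have "0 \<le> g \<omega> * cmod (iexp (U n \<omega>) - iexp (N n \<omega>))" using g by simp
      with * show "0 \<le> l * (N n \<omega>)\<^sup>2 + h n \<omega>" by linarith
    qed
    also have "\<dots> = l * (\<integral>\<omega>. (N n \<omega>)\<^sup>2 \<partial>M) + (\<integral>\<omega>. h n \<omega> \<partial>M)"
      using int h_int by simp
    also have "l * (\<integral>\<omega>. (N n \<omega>)\<^sup>2 \<partial>M) \<le> l * (C + 1)"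
      using C[of n] l by (intro mult_left_mono) auto
    also have "l * (C + 1) = r / 2" using C0 by (simp add: l_def field_simps)
    finally show ?thesis by simp
  qed
  moreover have "0 \<le> (\<integral>\<omega>. g \<omega> * cmod (iexp (U n \<omega>) - iexp (N n \<omega>)) \<partial>M)" for n
    by (rule integral_nonneg_AE) (simp add: g)
  ultimately have "\<forall>\<^sub>F n in sequentially. norm ((\<integral>\<omega>. g \<omega> * cmod (iexp (U n \<omega>) - iexp (N n \<omega>)) \<partial>M) - 0) < r"
    by (auto elim!: eventually_mono) (smt (verit) field_sum_of_halves)
  then show "\<exists>no. \<forall>n\<ge>no. norm ((\<integral>\<omega>. g \<omega> * cmod (iexp (U n \<omega>) - iexp (N n \<omega>)) \<partial>M) - 0) < r"
    by (simp add: eventually_sequentially)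
qed

section \<open>Conditional laws, independence and Bernoulli's inequality\<close>

text \<open>The conditional law has density \<open>indicator A / prob A\<close> with respect to
  \<open>M\<close>, so conditional characteristic functions become integrals over \<open>A\<close>
  under the original measure.\<close>

lemma (in prob_space) char_distr_uniform_measure:
  assumes A: "A \<in> events" "prob A \<noteq> 0" and [measurable]: "f \<in> borel_measurable M"
  shows "char (distr (uniform_measure M A) borel f) t = (\<integral>\<omega>. indicator A \<omega> * iexp (t * f \<omega>) \<partial>M) / prob A"
proof -
  note [measurable] = A(1)
  have d: "uniform_measure M A = density M (\<lambda>\<omega>. ennreal (indicator A \<omega> / prob A))"
    unfolding uniform_measure_def
    by (rule arg_cong[where f="density M"], rule ext)
       (use A(2) in \<open>auto simp: emeasure_eq_measure indicator_def divide_ennreal measure_nonneg zero_less_measure_iff simp flip: ennreal_1\<close>)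
  have "char (distr (uniform_measure M A) borel f) t = (\<integral>\<omega>. iexp (t * f \<omega>) \<partial>uniform_measure M A)"
    unfolding char_def by (subst integral_distr) auto
  also have "\<dots> = (\<integral>\<omega>. (indicator A \<omega> / prob A) *\<^sub>R iexp (t * f \<omega>) \<partial>M)"
    unfolding d by (subst integral_density) auto
  also have "\<dots> = (\<integral>\<omega>. (indicator A \<omega> * iexp (t * f \<omega>)) / prob A \<partial>M)"
    by (rule Bochner_Integration.integral_cong) (auto simp: scaleR_conv_of_real indicator_def)
  also have "\<dots> = (\<integral>\<omega>. indicator A \<omega> * iexp (t * f \<omega>) \<partial>M) / prob A" by simp
  finally show ?thesis .
qed

text \<open>The walk's independence assumptions concern sigma-algebras, whereas the product rule for
  integrals concerns random variables. The sigma-algebras generated by \<open>f\<close> and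
  \<open>g\<close> lie in \<open>N1\<close> and \<open>N2\<close>, so independence passes to
  them.\<close>

lemma (in prob_space) indep_set_lebesgue_integral:
  fixes f g :: "'a \<Rightarrow> 'b :: {real_normed_field, banach, second_countable_topology}"
  assumes ind: "indep_set (sets N1) (sets N2)"
    and sp: "space N1 = space M" "space N2 = space M"
    and f: "f \<in> borel_measurable N1" and g: "g \<in> borel_measurable N2"
    and int: "integrable M f" "integrable M g"
  shows "(\<integral>\<omega>. f \<omega> * g \<omega> \<partial>M) = (\<integral>\<omega>. f \<omega> \<partial>M) * (\<integral>\<omega>. g \<omega> \<partial>M)"
proof (rule indep_var_lebesgue_integral[OF _ int])
  have "{f -` A \<inter> space M |A. A \<in> sets borel} \<subseteq> sets N1"
    using measurable_sets[OF f] sp by auto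
  then have s1: "sigma_sets (space M) {f -` A \<inter> space M |A. A \<in> sets borel} \<subseteq> sets N1"
    using sets.sigma_sets_subset[of _ N1] sp by auto
  have "{g -` A \<inter> space M |A. A \<in> sets borel} \<subseteq> sets N2"
    using measurable_sets[OF g] sp by auto
  then have s2: "sigma_sets (space M) {g -` A \<inter> space M |A. A \<in> sets borel} \<subseteq> sets N2"
    using sets.sigma_sets_subset[of _ N2] sp by auto
  have "random_variable borel f" "random_variable borel g"
    using int by auto
  with ind s1 s2 show "indep_var borel f borel g"
    unfolding indep_var_eq indep_sets2_eq by blast
qed

text \<open>Concavity of \<open>ln\<close>: its tangent at \<open>1 + a * x\<close>, the mean of
  \<open>1 + x\<close> and \<open>1\<close> with weights \<open>a\<close> and \<open>1 - a\<close>,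
  lies above its graph.\<close>

lemma one_plus_powr_le:
  fixes x a :: real
  assumes "0 \<le> a" "a \<le> 1" "0 \<le> x"
  shows "(1 + x) powr a \<le> 1 + a * x"
proof -
  have c: "0 < 1 + a * x" using assms by (smt (verit) mult_nonneg_nonneg)
  have "a * ln ((1 + x) / (1 + a * x)) + (1 - a) * ln (1 / (1 + a * x))
      \<le> a * ((1 + x) / (1 + a * x) - 1) + (1 - a) * (1 / (1 + a * x) - 1)"
    using assms c by (intro add_mono mult_left_mono ln_le_minus_one) auto
  also have "\<dots> = 0" using c by (simp add: divide_simps) (simp add: algebra_simps)
  finally have "a * ln (1 + x) \<le> ln (1 + a * x)"
    using assms c by (simp add: ln_div algebra_simps)
  then have "exp (a * ln (1 + x)) \<le> 1 + a * x" using c by (metis exp_le_cancel_iff exp_ln)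
  then show ?thesis using assms by (simp add: powr_def)
qed

text \<open>Apply the concave case with exponent \<open>1 / a\<close> to \<open>a * x\<close> and
  raise both sides to the power \<open>a\<close>.\<close>

lemma one_plus_powr_ge:
  fixes x a :: real
  assumes "1 \<le> a" "0 \<le> x"
  shows "1 + a * x \<le> (1 + x) powr a"
proof -
  have "(1 + a * x) powr (1 / a) \<le> 1 + (1 / a) * (a * x)"
    using assms by (intro one_plus_powr_le) auto
  then have "((1 + a * x) powr (1 / a)) powr a \<le> (1 + x) powr a"
    using assms by (intro powr_mono2) auto
  then show ?thesis using assms by (simp add: powr_powr)
qed

subsection \<open>Pathwise asymptotics\<close>

text \<open>The deterministic size of the quadratic variation: on paths with nonzero limit L, the
  sum of the squares of \<open>S\<^sub>k / k\<close> is asymptotic to L^2 times this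
  quantity.\<close>

definition weight_sum :: "real \<Rightarrow> nat \<Rightarrow> real" where
  "weight_sum a n = (\<Sum>k=1..<n. (real k powr (a - 1))\<^sup>2)"

section \<open>Growth of the weights and choice of the window\<close>

lemma weight_le_1: "a \<le> 1 \<Longrightarrow> 1 \<le> k \<Longrightarrow> real k powr (a - 1) \<le> 1"
  using powr_mono[of "a - 1" 0 "real k"] by simp

lemma weight_sum_le:
  assumes "a \<le> 1"
  shows "weight_sum a n \<le> real n"
proof -
  have "weight_sum a n \<le> (\<Sum>k=1..<n. 1)"
    unfolding weight_sum_def
    by (intro sum_mono power_le_one) (use weight_le_1[OF assms] in auto)
  then show ?thesis by simp
qed

lemma weight_sum_nonneg: "0 \<le> weight_sum a n"
  unfolding weight_sum_def by (intro sum_nonneg) simp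

text \<open>Each squared weight is at least \<open>n powr (2 * a - 2)\<close>, so the
  \<open>n - 1\<close> of them add up to at least half of \<open>n powr (2 * a - 1)\<close>. This
  exponent is positive exactly when \<open>a > 1/2\<close>, that is, in the superdiffusive
  regime.\<close>

lemma filterlim_weight_sum:
  assumes a: "1/2 < a" "a \<le> 1"
  shows "filterlim (weight_sum a) at_top sequentially"
proof (rule filterlim_at_top_mono)
  have "filterlim (\<lambda>n. exp ((2 * a - 1) * ln (real n))) at_top sequentially"
    by (rule filterlim_compose[OF exp_at_top], subst filterlim_tendsto_pos_mult_at_top_iff[OF tendsto_const])
       (use a in \<open>auto intro: filterlim_compose[OF ln_at_top filterlim_real_sequentially]\<close>)
  then have "filterlim (\<lambda>n. real n powr (2 * a - 1)) at_top sequentially"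
    by (rule filterlim_at_top_mono)
       (use eventually_ge_at_top[of "1 :: nat"] in \<open>eventually_elim, simp add: powr_def\<close>)
  then show "filterlim (\<lambda>n. (1/2) * real n powr (2 * a - 1)) at_top sequentially"
    by (subst filterlim_tendsto_pos_mult_at_top_iff[OF tendsto_const]) auto
  show "\<forall>\<^sub>F n in sequentially. (1/2) * real n powr (2 * a - 1) \<le> weight_sum a n"
    using eventually_ge_at_top[of 2]
  proof eventually_elim
    case (elim n)
    have "(1/2) * real n powr (2 * a - 1) = (real n / 2) * real n powr (2 * a - 2)"
      using elim powr_add[of "real n" 1 "2 * a - 2"] by simp
    also have "\<dots> \<le> (real n - 1) * real n powr (2 * a - 2)"
      using elim by (intro mult_right_mono) auto
    also have "\<dots> = (\<Sum>k=1..<n. real n powr (2 * a - 2))"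
      using elim by (simp add: of_nat_diff)
    also have "\<dots> \<le> weight_sum a n"
      unfolding weight_sum_def
    proof (rule sum_mono)
      fix k assume k: "k \<in> {1..<n}"
      have "real n powr (2 * a - 2) \<le> real k powr (2 * a - 2)"
        using k a by (intro powr_mono2') auto
      also have "\<dots> = (real k powr (a - 1))\<^sup>2"
        by (simp add: power2_eq_square flip: powr_add)
      finally show "real n powr (2 * a - 2) \<le> (real k powr (a - 1))\<^sup>2" .
    qed
    finally show ?case .
  qed
qed

text \<open>The time \<open>m n\<close> must tend to infinity so that the rescaled position at that
  time approximates its limit, yet be small against the square root of the total weight so that the
  bounded terms before it are negligible.\<close>

lemma ex_window:
  assumes a: "1/2 < a" "a \<le> 1"
  obtains m :: "nat \<Rightarrow> nat" where "\<And>n. 1 \<le> m n" and "filterlim m at_top sequentially"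
    and "\<forall>\<^sub>F n in sequentially. m n \<le> n" and "(\<lambda>n. real (m n) / sqrt (weight_sum a n)) \<longlonglongrightarrow> 0"
proof
  define B where "B = weight_sum a"
  \<comment> \<open>The fourth root of the total weight is of smaller order than its square root;
    adding one keeps the window away from time 0.\<close>
  define m where "m n = nat \<lfloor>sqrt (sqrt (B n))\<rfloor> + 1" for n
  have B: "filterlim B at_top sequentially" unfolding B_def by (rule filterlim_weight_sum[OF a])
  have sB: "filterlim (\<lambda>n. sqrt (B n)) at_top sequentially"
    by (rule filterlim_compose[OF sqrt_at_top B])
  have ssB: "filterlim (\<lambda>n. sqrt (sqrt (B n))) at_top sequentially"
    by (rule filterlim_compose[OF sqrt_at_top sB])
  have B0: "0 \<le> B n" for n unfolding B_def by (rule weight_sum_nonneg)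
  have up: "real (m n) \<le> sqrt (sqrt (B n)) + 1" for n
    unfolding m_def using B0[of n] by (simp add: of_nat_nat)
  have lo: "sqrt (sqrt (B n)) \<le> real (m n)" for n
    unfolding m_def using B0[of n] by (simp add: of_nat_nat) linarith
  show "1 \<le> m n" for n by (simp add: m_def)
  show "filterlim m at_top sequentially"
    using filterlim_at_top_mono[OF ssB] lo
    by (subst filterlim_sequentially_iff_filterlim_real) auto
  have "(\<lambda>n. 1 / sqrt (sqrt (B n)) + 1 / sqrt (B n)) \<longlonglongrightarrow> 0 + 0"
    by (intro tendsto_add real_tendsto_divide_at_top[OF tendsto_const] sB ssB)
  then have lim0: "(\<lambda>n. 1 / sqrt (sqrt (B n)) + 1 / sqrt (B n)) \<longlonglongrightarrow> 0" by simp
  have le: "real (m n) / sqrt (B n) \<le> 1 / sqrt (sqrt (B n)) + 1 / sqrt (B n)" for n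
  proof -
    have "real (m n) / sqrt (B n) \<le> (sqrt (sqrt (B n)) + 1) / sqrt (B n)"
      using up B0 by (intro divide_right_mono) auto
    also have "\<dots> = sqrt (sqrt (B n)) / sqrt (B n) + 1 / sqrt (B n)" by (rule add_divide_distrib)
    also have "sqrt (sqrt (B n)) / sqrt (B n) = 1 / sqrt (sqrt (B n))"
      using B0[of n] real_sqrt_mult_self[of "sqrt (B n)"]
      by (cases "B n = 0") (auto simp: field_simps)
    finally show ?thesis .
  qed
  have lim: "(\<lambda>n. real (m n) / sqrt (B n)) \<longlonglongrightarrow> 0"
    by (rule tendsto_sandwich[OF _ _ tendsto_const lim0]) (use le B0 in auto)
  then show "(\<lambda>n. real (m n) / sqrt (weight_sum a n)) \<longlonglongrightarrow> 0" unfolding B_def .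
  have "\<forall>\<^sub>F n in sequentially. real (m n) / sqrt (B n) < 1"
    using lim by (rule order_tendstoD) simp
  moreover have "\<forall>\<^sub>F n in sequentially. 1 \<le> B n"
    using B by (simp add: filterlim_at_top)
  ultimately show "\<forall>\<^sub>F n in sequentially. m n \<le> n"
  proof eventually_elim
    case (elim n)
    have "real (m n) \<le> sqrt (B n)" using elim by (simp add: divide_less_eq split: if_splits)
    also have "\<dots> \<le> B n" using elim by (simp add: real_le_lsqrt power2_eq_square mult_le_cancel_left1)
    also have "\<dots> \<le> real n" unfolding B_def by (rule weight_sum_le[OF a(2)])
    finally show ?case by simp
  qed
qed

text \<open>Joint convergence in \<open>n\<close> and \<open>k\<close> allows limits of doubly
  indexed expressions to be computed with the ordinary limit rules. Since \<open>m n\<close> tends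
  to infinity, it yields uniformity over the window.\<close>

lemma uniform_on_window:
  fixes u :: "nat \<Rightarrow> nat \<Rightarrow> real"
  assumes u: "((\<lambda>(n, k). u n k) \<longlongrightarrow> c) (sequentially \<times>\<^sub>F sequentially)"
    and m: "filterlim m at_top sequentially" and e: "0 < e"
  shows "\<forall>\<^sub>F n in sequentially. \<forall>k\<in>{m n..<n}. \<bar>u n k - c\<bar> \<le> e"
proof -
  have "\<forall>\<^sub>F z in sequentially \<times>\<^sub>F sequentially. dist (case z of (n, k) \<Rightarrow> u n k) c < e"
    using tendstoD[OF u e] .
  then obtain N where N: "\<And>n k. N \<le> n \<Longrightarrow> N \<le> k \<Longrightarrow> dist (u n k) c < e"
    unfolding eventually_prod_sequentially by auto
  have "\<forall>\<^sub>F n in sequentially. N \<le> m n" using m by (simp add: filterlim_at_top)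
  with eventually_ge_at_top[of N] show ?thesis
    by eventually_elim (use N in \<open>force simp: dist_real_def intro: less_imp_le\<close>)
qed

text \<open>
  The clamp makes the frozen normalization bounded; it is eventually inactive on paths with \<open>L \<noteq> 0\<close>,
  because the ratios it is applied to tend to \<open>sgn L\<close>.
\<close>

definition clamp2 :: "real \<Rightarrow> real" where
  "clamp2 x = max (- 2) (min 2 x)"

lemma abs_clamp2_le: "\<bar>clamp2 x\<bar> \<le> 2" by (simp add: clamp2_def)

lemma clamp2_eq: "\<bar>x\<bar> \<le> 2 \<Longrightarrow> clamp2 x = x" by (simp add: clamp2_def)

text \<open>In the application \<open>s k = S\<^sub>k / k\<^sup>a\<close> and \<open>e k = \<epsilon>\<^sub>k\<close>, so that \<open>s k * k powr (a - 1) = S\<^sub>k / k\<close>.\<close>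

locale superdiffusive_path =
  fixes a :: real and m :: "nat \<Rightarrow> nat" and s e :: "nat \<Rightarrow> real" and l :: real
  assumes a: "1/2 < a" "a \<le> 1"
    and m1: "\<And>n. 1 \<le> m n" and m_top: "filterlim m at_top sequentially"
    and m_le: "\<forall>\<^sub>F n in sequentially. m n \<le> n"
    and m_small: "(\<lambda>n. real (m n) / sqrt (weight_sum a n)) \<longlonglongrightarrow> 0"
    and s: "s \<longlonglongrightarrow> l" and l: "l \<noteq> 0"
    and Y_le: "\<And>k. 1 \<le> k \<Longrightarrow> \<bar>s k * real k powr (a - 1)\<bar> \<le> 1"
    and e_le: "\<And>k. 1 \<le> k \<Longrightarrow> \<bar>e k\<bar> \<le> 2"
    and e_sq: "(\<lambda>k. (e k)\<^sup>2) \<longlonglongrightarrow> 1"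
begin

abbreviation "B \<equiv> weight_sum a"
abbreviation "w k \<equiv> real k powr (a - 1)"

text \<open>\<open>R\<close> is the self-normalized sum, \<open>N\<close> its version over the
  window with the normalization frozen at time \<open>m n\<close>, and \<open>D\<close> the random
  part of the true normalization. Thus \<open>R n\<close> is close to \<open>N n\<close> times the
  ratio of \<open>\<bar>s (m n)\<bar>\<close> to \<open>D n\<close>.\<close>

definition "N n = (\<Sum>k=m n..<n. clamp2 (s k / \<bar>s (m n)\<bar>) * w k / sqrt (B n) * e k)"
definition "D n = sqrt ((\<Sum>k=1..<n. (s k * w k)\<^sup>2) / B n)"
definition "R n = (\<Sum>k=1..<n. s k * w k * e k) / sqrt (\<Sum>k=1..<n. (s k * w k)\<^sup>2)"

section \<open>Limits along a path with nonzero limit\<close>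

lemma B_top: "filterlim B at_top sequentially"
  by (rule filterlim_weight_sum[OF a])

lemma B_pos: "\<forall>\<^sub>F n in sequentially. 1 \<le> B n"
  using B_top by (simp add: filterlim_at_top)

lemma head_small: "(\<lambda>n. real (m n) / B n) \<longlonglongrightarrow> 0"
proof (rule tendsto_sandwich[OF _ _ tendsto_const m_small])
  show "\<forall>\<^sub>F n in sequentially. real (m n) / B n \<le> real (m n) / sqrt (B n)"
    using B_pos
  proof eventually_elim
    case (elim n)
    have "sqrt (B n) \<le> B n" using elim by (simp add: real_le_lsqrt power2_eq_square mult_le_cancel_left1)
    then show ?case using elim by (intro divide_left_mono) auto
  qed
qed (simp add: weight_sum_nonneg)

text \<open>The squared weights before \<open>m n\<close> sum to at most \<open>m n\<close>, since
  no weight exceeds one, and \<open>m n / B n\<close> tends to zero by the choice of the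
  window.\<close>

lemma average:
  assumes u: "((\<lambda>(n, k). u n k) \<longlongrightarrow> c) (sequentially \<times>\<^sub>F sequentially)"
  shows "(\<lambda>n. (\<Sum>k=m n..<n. u n k * (w k)\<^sup>2) / B n) \<longlonglongrightarrow> c"
  unfolding weight_sum_def
proof (rule weighted_average_tendsto)
  show "\<forall>\<^sub>F n in sequentially. 0 < (\<Sum>k=1..<n. (w k)\<^sup>2)"
    using B_pos unfolding weight_sum_def by eventually_elim simp
  show "\<forall>\<^sub>F n in sequentially. 1 \<le> m n \<and> m n \<le> n"
    using m_le m1 by simp
  show "(\<lambda>n. (\<Sum>k=1..<m n. (w k)\<^sup>2) / (\<Sum>k=1..<n. (w k)\<^sup>2)) \<longlonglongrightarrow> 0"
    unfolding weight_sum_def[symmetric]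
    by (rule tendsto_sandwich[OF _ _ tendsto_const head_small])
       (auto simp: weight_sum_nonneg intro!: always_eventually divide_right_mono weight_sum_le a)
  show "\<forall>\<^sub>F n in sequentially. \<forall>k\<in>{m n..<n}. \<bar>u n k - c\<bar> \<le> e" if "0 < e" for e
    by (rule uniform_on_window[OF u m_top that])
qed simp

lemma s_fst: "((\<lambda>x. s (m (fst x))) \<longlongrightarrow> l) (sequentially \<times>\<^sub>F sequentially)"
  by (rule filterlim_compose[OF s filterlim_compose[OF m_top filterlim_fst]])

lemma s_snd: "((\<lambda>x. s (snd x)) \<longlongrightarrow> l) (sequentially \<times>\<^sub>F sequentially)"
  by (rule filterlim_compose[OF s filterlim_snd])

lemma e_snd: "((\<lambda>x. (e (snd x))\<^sup>2) \<longlongrightarrow> 1) (sequentially \<times>\<^sub>F sequentially)"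
  by (rule filterlim_compose[OF e_sq filterlim_snd])

lemma ratio: "((\<lambda>x. s (snd x) / \<bar>s (m (fst x))\<bar>) \<longlongrightarrow> l / \<bar>l\<bar>) (sequentially \<times>\<^sub>F sequentially)"
  using l by (intro tendsto_divide tendsto_rabs s_fst s_snd) auto

text \<open>The clamped ratio tends to the sign of \<open>l\<close>, whose square is one, and
  \<open>(e k)\<^sup>2\<close> tends to one, so the sum is a weighted average of quantities that
  tend to \<open>t\<^sup>2\<close>.\<close>

lemma quadratic_variation:
  "(\<lambda>n. \<Sum>k=m n..<n. (t * clamp2 (s k / \<bar>s (m n)\<bar>) * w k / sqrt (B n) * e k)\<^sup>2) \<longlonglongrightarrow> t\<^sup>2"
proof -
  have "((\<lambda>x. t\<^sup>2 * (clamp2 (s (snd x) / \<bar>s (m (fst x))\<bar>))\<^sup>2 * (e (snd x))\<^sup>2)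
      \<longlongrightarrow> t\<^sup>2 * (clamp2 (l / \<bar>l\<bar>))\<^sup>2 * 1) (sequentially \<times>\<^sub>F sequentially)"
    unfolding clamp2_def by (intro tendsto_intros ratio e_snd)
  moreover have "(clamp2 (l / \<bar>l\<bar>))\<^sup>2 = 1" using l by (cases "l > 0") (auto simp: clamp2_def)
  ultimately have "((\<lambda>(n, k). t\<^sup>2 * (clamp2 (s k / \<bar>s (m n)\<bar>))\<^sup>2 * (e k)\<^sup>2)
      \<longlongrightarrow> t\<^sup>2) (sequentially \<times>\<^sub>F sequentially)"
    by (simp add: case_prod_unfold)
  from average[OF this]
  have "(\<lambda>n. (\<Sum>k=m n..<n. t\<^sup>2 * (clamp2 (s k / \<bar>s (m n)\<bar>))\<^sup>2 * (e k)\<^sup>2 * (w k)\<^sup>2) / B n) \<longlonglongrightarrow> t\<^sup>2" .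
  moreover have "(\<Sum>k=m n..<n. t\<^sup>2 * (clamp2 (s k / \<bar>s (m n)\<bar>))\<^sup>2 * (e k)\<^sup>2 * (w k)\<^sup>2) / B n
      = (\<Sum>k=m n..<n. (t * clamp2 (s k / \<bar>s (m n)\<bar>) * w k / sqrt (B n) * e k)\<^sup>2)" for n
    unfolding sum_divide_distrib
    by (rule sum.cong) (auto simp: power_mult_distrib power_divide weight_sum_nonneg)
  ultimately show ?thesis by simp
qed

text \<open>On the window the average of \<open>(s k)\<^sup>2\<close> tends to
  \<open>l\<^sup>2\<close>; before it there are fewer than \<open>m n\<close> terms, each at most
  one.\<close>

lemma D_lim: "D \<longlonglongrightarrow> \<bar>l\<bar>"
proof -
  have "((\<lambda>x. (s (snd x))\<^sup>2) \<longlongrightarrow> l\<^sup>2) (sequentially \<times>\<^sub>F sequentially)"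
    by (intro tendsto_intros s_snd)
  then have "((\<lambda>(n :: nat, k). (s k)\<^sup>2) \<longlongrightarrow> l\<^sup>2) (sequentially \<times>\<^sub>F sequentially)"
    by (simp add: case_prod_unfold)
  from average[OF this] have 1: "(\<lambda>n. (\<Sum>k=m n..<n. (s k * w k)\<^sup>2) / B n) \<longlonglongrightarrow> l\<^sup>2"
    by (simp add: power_mult_distrib)
  have 2: "(\<lambda>n. (\<Sum>k=1..<m n. (s k * w k)\<^sup>2) / B n) \<longlonglongrightarrow> 0"
  proof (rule tendsto_sandwich[OF _ _ tendsto_const head_small])
    have "(\<Sum>k=1..<m n. (s k * w k)\<^sup>2) / B n \<le> real (m n) / B n" for n
    proof (rule divide_right_mono[OF _ weight_sum_nonneg])
      have "(\<Sum>k=1..<m n. (s k * w k)\<^sup>2) \<le> (\<Sum>k=1..<m n. 1)"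
        by (rule sum_mono) (use Y_le in \<open>simp add: abs_square_le_1\<close>)
      then show "(\<Sum>k=1..<m n. (s k * w k)\<^sup>2) \<le> real (m n)" by simp
    qed
    then show "\<forall>\<^sub>F n in sequentially. (\<Sum>k=1..<m n. (s k * w k)\<^sup>2) / B n \<le> real (m n) / B n" by simp
  qed (auto simp: weight_sum_nonneg intro!: sum_nonneg divide_nonneg_nonneg always_eventually)
  have "(\<lambda>n. (\<Sum>k=1..<n. (s k * w k)\<^sup>2) / B n) \<longlonglongrightarrow> 0 + l\<^sup>2"
    using m_le
    by (rule Lim_transform_eventually[OF tendsto_add[OF 2 1], OF eventually_mono])
       (use m1 in \<open>simp add: sum.atLeastLessThan_concat flip: add_divide_distrib\<close>)
  from tendsto_real_sqrt[OF this] show ?thesis unfolding D_def by simp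
qed

lemma ratio_lim: "(\<lambda>n. \<bar>s (m n)\<bar> / D n - 1) \<longlonglongrightarrow> 0"
proof -
  have "(\<lambda>n. \<bar>s (m n)\<bar> / D n - 1) \<longlonglongrightarrow> \<bar>l\<bar> / \<bar>l\<bar> - 1"
    using l by (intro tendsto_diff tendsto_divide tendsto_rabs D_lim filterlim_compose[OF s m_top] tendsto_const) auto
  then show ?thesis using l by simp
qed

text \<open>Once the clamp is inactive, \<open>N n\<close> times the ratio of the normalizations is
  exactly the part of \<open>R n\<close> with \<open>k \<ge> m n\<close>. What remains are fewer
  than \<open>m n\<close> terms of size at most 2, divided by
  \<open>D n * sqrt (B n)\<close>.\<close>

lemma remainder_lim: "(\<lambda>n. R n - N n * (\<bar>s (m n)\<bar> / D n)) \<longlonglongrightarrow> 0"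
proof (rule tendsto_rabs_zero_cancel, rule tendsto_sandwich[OF _ _ tendsto_const])
  have "(\<lambda>n. real (m n) / sqrt (B n) * (2 / D n)) \<longlonglongrightarrow> 0 * (2 / \<bar>l\<bar>)"
    using l by (intro tendsto_mult m_small tendsto_divide D_lim tendsto_const) auto
  then show "(\<lambda>n. real (m n) / sqrt (B n) * (2 / D n)) \<longlonglongrightarrow> 0" by simp
  have "((\<lambda>(n, k). s k / \<bar>s (m n)\<bar>) \<longlongrightarrow> l / \<bar>l\<bar>) (sequentially \<times>\<^sub>F sequentially)"
    using ratio by (simp add: case_prod_unfold)
  from uniform_on_window[OF this m_top zero_less_one]
  have unclamped: "\<forall>\<^sub>F n in sequentially. \<forall>k\<in>{m n..<n}. clamp2 (s k / \<bar>s (m n)\<bar>) = s k / \<bar>s (m n)\<bar>"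
  proof eventually_elim
    case (elim n)
    \<comment> \<open>The limit of the ratios has modulus one, so a deviation of at most one stays
      within the range of the clamp.\<close>
    have "\<bar>l / \<bar>l\<bar>\<bar> = 1" using l by simp
    with elim show ?case by (intro ballI clamp2_eq) (smt (verit))
  qed
  have "\<forall>\<^sub>F n in sequentially. s (m n) \<noteq> 0"
    using filterlim_compose[OF s m_top] l by (rule tendsto_imp_eventually_ne)
  moreover have "\<forall>\<^sub>F n in sequentially. 0 < D n"
    using D_lim l by (intro order_tendstoD(1)[OF D_lim]) simp
  ultimately show "\<forall>\<^sub>F n in sequentially. \<bar>R n - N n * (\<bar>s (m n)\<bar> / D n)\<bar> \<le> real (m n) / sqrt (B n) * (2 / D n)"
    using unclamped m_le B_pos
  proof eventually_elim
    case (elim n)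
    define Q where "Q I = (\<Sum>k\<in>I. s k * w k * e k)" for I :: "nat set"
    have sq: "sqrt (\<Sum>k=1..<n. (s k * w k)\<^sup>2) = D n * sqrt (B n)"
      using elim(5) by (simp add: D_def flip: real_sqrt_mult)
    have "N n = (\<Sum>k=m n..<n. s k * w k * e k / (\<bar>s (m n)\<bar> * sqrt (B n)))"
      unfolding N_def by (rule sum.cong) (use elim(3) in \<open>auto simp: field_simps\<close>)
    also have "\<dots> = Q {m n..<n} / (\<bar>s (m n)\<bar> * sqrt (B n))"
      by (simp add: Q_def sum_divide_distrib)
    finally have N: "N n * (\<bar>s (m n)\<bar> / D n) = Q {m n..<n} / (D n * sqrt (B n))"
      using elim by simp
    have "R n = (Q {1..<m n} + Q {m n..<n}) / (D n * sqrt (B n))"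
      unfolding R_def sq Q_def using elim m1 by (simp add: sum.atLeastLessThan_concat)
    then have "R n - N n * (\<bar>s (m n)\<bar> / D n) = Q {1..<m n} / (D n * sqrt (B n))"
      unfolding N by (simp add: add_divide_distrib)
    then have "\<bar>R n - N n * (\<bar>s (m n)\<bar> / D n)\<bar> = \<bar>Q {1..<m n}\<bar> / (D n * sqrt (B n))"
      using elim by (simp add: abs_divide abs_mult)
    also have "\<dots> \<le> (2 * real (m n)) / (D n * sqrt (B n))"
    proof (rule divide_right_mono)
      have "\<bar>Q {1..<m n}\<bar> \<le> (\<Sum>k=1..<m n. 1 * 2)"
        unfolding Q_def
        by (rule order_trans[OF sum_abs sum_mono], subst abs_mult, rule mult_mono)
           (use Y_le e_le in auto)
      then show "\<bar>Q {1..<m n}\<bar> \<le> 2 * real (m n)" by simp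
      show "0 \<le> D n * sqrt (B n)" using elim by simp
    qed
    also have "\<dots> = real (m n) / sqrt (B n) * (2 / D n)" by (simp add: mult.commute)
    finally show ?case .
  qed
qed simp

text \<open>By McLeish's expansion, \<open>iexp (t * N n)\<close> is asymptotic to the product times
  \<open>exp (- V n / 2)\<close>, where \<open>V n\<close> is the quadratic variation; the limit
  \<open>t\<^sup>2\<close> then takes the place of \<open>V n\<close>.\<close>

lemma McLeish_remainder:
  "(\<lambda>n. iexp (t * N n) * exp (t\<^sup>2 / 2) - (\<Prod>k=m n..<n. 1 + \<i> * complex_of_real (t * clamp2 (s k / \<bar>s (m n)\<bar>) * w k / sqrt (B n) * e k))) \<longlonglongrightarrow> 0"
proof -
  define x where "x n k = t * clamp2 (s k / \<bar>s (m n)\<bar>) * w k / sqrt (B n) * e k" for n k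
  define V where "V n = (\<Sum>k=m n..<n. (x n k)\<^sup>2)" for n
  define T where "T n = (\<Prod>k=m n..<n. 1 + \<i> * complex_of_real (x n k))" for n
  have V: "V \<longlonglongrightarrow> t\<^sup>2" unfolding V_def x_def by (rule quadratic_variation)
  \<comment> \<open>A bound for every summand: 2 from the clamp, 1 from the weight and 2 from
    \<open>e k\<close>.\<close>
  define \<delta> where "\<delta> n = 4 * \<bar>t\<bar> / sqrt (B n)" for n
  have sB: "filterlim (\<lambda>n. sqrt (B n)) at_top sequentially"
    by (rule filterlim_compose[OF sqrt_at_top B_top])
  have \<delta>: "\<delta> \<longlonglongrightarrow> 0" unfolding \<delta>_def by (rule real_tendsto_divide_at_top[OF tendsto_const sB])
  have x_le: "\<bar>x n k\<bar> \<le> \<delta> n" if "k \<in> {m n..<n}" for n k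
  proof -
    have k: "1 \<le> k" using that m1[of n] by simp
    have "\<bar>x n k\<bar> = \<bar>t\<bar> * \<bar>clamp2 (s k / \<bar>s (m n)\<bar>)\<bar> * w k * \<bar>e k\<bar> / sqrt (B n)"
      by (simp add: x_def abs_mult abs_divide weight_sum_nonneg)
    also have "\<dots> \<le> (\<bar>t\<bar> * 2 * 1 * 2) / sqrt (B n)"
      by (intro divide_right_mono mult_mono abs_clamp2_le weight_le_1 a k e_le)
         (auto simp: weight_sum_nonneg)
    finally show ?thesis by (simp add: \<delta>_def)
  qed
  have e1: "(\<lambda>n. iexp (t * N n) - T n * complex_of_real (exp (- V n / 2))) \<longlonglongrightarrow> 0"
  proof (rule tendsto_norm_zero_cancel, rule tendsto_sandwich[OF _ _ tendsto_const])
    show "(\<lambda>n. \<delta> n * V n) \<longlonglongrightarrow> 0" using tendsto_mult[OF \<delta> V] by simp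
    have "\<forall>\<^sub>F n in sequentially. \<delta> n < 1" using \<delta> by (rule order_tendstoD) simp
    then show "\<forall>\<^sub>F n in sequentially. cmod (iexp (t * N n) - T n * complex_of_real (exp (- V n / 2))) \<le> \<delta> n * V n"
    proof eventually_elim
      case (elim n)
      have "t * N n = (\<Sum>k=m n..<n. x n k)"
        unfolding N_def x_def sum_distrib_left by (rule sum.cong) auto
      then have "cmod (iexp (t * N n) - T n * complex_of_real (exp (- V n / 2))) \<le> (\<Sum>k=m n..<n. \<bar>x n k\<bar> ^ 3)"
        unfolding T_def V_def
        using order_trans[OF x_le less_imp_le[OF elim]] by (simp only:) (intro McLeish_expansion, auto)
      \<comment> \<open>The cubic error is at most the largest summand times the quadratic
        variation, and the latter converges.\<close>
      also have "\<dots> \<le> (\<Sum>k=m n..<n. \<delta> n * (x n k)\<^sup>2)"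
      proof (rule sum_mono)
        fix k assume "k \<in> {m n..<n}"
        then have "\<bar>x n k\<bar> * (x n k)\<^sup>2 \<le> \<delta> n * (x n k)\<^sup>2" by (intro mult_right_mono x_le) auto
        then show "\<bar>x n k\<bar> ^ 3 \<le> \<delta> n * (x n k)\<^sup>2"
          by (simp add: power3_eq_cube power2_eq_square abs_mult_self_eq mult.assoc)
      qed
      finally show ?case by (simp add: V_def sum_distrib_left)
    qed
  qed simp
  have Tb: "cmod (T n) \<le> exp (V n / 2)" for n
    unfolding T_def V_def by (rule cmod_prod_1_plus_ii_le)
  \<comment> \<open>Here \<open>V n\<close> gives way to its limit; the product stays bounded
    because \<open>exp (V n / 2)\<close> converges.\<close>
  have e2: "(\<lambda>n. T n * complex_of_real (exp (t\<^sup>2 / 2) * exp (- V n / 2) - 1)) \<longlonglongrightarrow> 0"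
  proof (rule tendsto_norm_zero_cancel, rule tendsto_sandwich[OF _ _ tendsto_const])
    have "(\<lambda>n. exp (V n / 2) * \<bar>exp (t\<^sup>2 / 2) * exp (- V n / 2) - 1\<bar>)
        \<longlonglongrightarrow> exp (t\<^sup>2 / 2) * \<bar>exp (t\<^sup>2 / 2) * exp (- t\<^sup>2 / 2) - 1\<bar>"
      by (intro tendsto_intros V) auto
    then show "(\<lambda>n. exp (V n / 2) * \<bar>exp (t\<^sup>2 / 2) * exp (- V n / 2) - 1\<bar>) \<longlonglongrightarrow> 0"
      by (simp flip: exp_add)
    show "\<forall>\<^sub>F n in sequentially. cmod (T n * complex_of_real (exp (t\<^sup>2 / 2) * exp (- V n / 2) - 1))
        \<le> exp (V n / 2) * \<bar>exp (t\<^sup>2 / 2) * exp (- V n / 2) - 1\<bar>"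
      unfolding norm_mult norm_of_real by (intro always_eventually allI mult_right_mono Tb) auto
  qed simp
  have "(\<lambda>n. (iexp (t * N n) - T n * complex_of_real (exp (- V n / 2))) * complex_of_real (exp (t\<^sup>2 / 2))
      + T n * complex_of_real (exp (t\<^sup>2 / 2) * exp (- V n / 2) - 1)) \<longlonglongrightarrow> 0 * complex_of_real (exp (t\<^sup>2 / 2)) + 0"
    by (intro tendsto_add tendsto_mult e1 e2 tendsto_const)
  moreover have "(\<lambda>n. (iexp (t * N n) - T n * complex_of_real (exp (- V n / 2))) * complex_of_real (exp (t\<^sup>2 / 2))
      + T n * complex_of_real (exp (t\<^sup>2 / 2) * exp (- V n / 2) - 1))
     = (\<lambda>n. iexp (t * N n) * complex_of_real (exp (t\<^sup>2 / 2)) - T n)"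
    by (rule ext) (simp add: algebra_simps del: of_real_exp)
  ultimately show ?thesis by (simp add: T_def x_def del: of_real_mult)
qed

end

subsection \<open>The martingale structure of the walk\<close>

context elephant_random_walk
begin

text \<open>The sigma-algebra generated by the first \<open>n\<close> steps, in the form that occurs
  in the assumption \<open>memory_indep\<close>.\<close>

definition history :: "nat \<Rightarrow> 'a measure" where
  "history n = vimage_algebra (space M) (\<lambda>\<omega>. \<lambda>i\<in>{1..n}. X i \<omega>) (Pi\<^sub>M {1..n} (\<lambda>_. borel))"

lemma space_history [simp]: "space (history n) = space M"
  by (simp add: history_def)

lemma X_history: "1 \<le> i \<Longrightarrow> i \<le> n \<Longrightarrow> X i \<in> borel_measurable (history n)"
proof -
  assume i: "1 \<le> i" "i \<le> n"
  have "(\<lambda>\<omega>. (\<lambda>j\<in>{1..n}. X j \<omega>) i) \<in> borel_measurable (history n)"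
    unfolding history_def
    by (rule measurable_compose[OF measurable_vimage_algebra1 measurable_component_singleton])
       (use i in \<open>auto simp: space_PiM\<close>)
  then show ?thesis using i by simp
qed

lemma history_mono: "m \<le> n \<Longrightarrow> f \<in> measurable (history m) N \<Longrightarrow> f \<in> measurable (history n) N"
proof -
  assume mn: "m \<le> n" and f: "f \<in> measurable (history m) N"
  have "(\<lambda>\<omega>. \<omega>) \<in> measurable (history n) (history m)"
    unfolding history_def[of m]
    by (rule measurable_vimage_algebra2, simp, rule measurable_restrict, rule X_history)
       (use mn in auto)
  from measurable_compose[OF this f] show ?thesis by simp
qed

lemma history_measurable: "f \<in> measurable (history n) N \<Longrightarrow> f \<in> measurable M N"
proof -
  assume f: "f \<in> measurable (history n) N"
  have "(\<lambda>\<omega>. \<omega>) \<in> measurable M (history n)"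
    unfolding history_def
    by (rule measurable_vimage_algebra2, simp, rule measurable_restrict, rule X_measurable) auto
  from measurable_compose[OF this f] show ?thesis by simp
qed

abbreviation S :: "nat \<Rightarrow> 'a \<Rightarrow> real" where "S \<equiv> erw_position X"

text \<open>The innovation of the step at time \<open>Suc k\<close>: the subtracted term is the
  conditional mean of that step given \<open>history k\<close>, which is the content of
  \<open>martingale_difference\<close>.\<close>

definition \<epsilon> :: "nat \<Rightarrow> 'a \<Rightarrow> real" where
  "\<epsilon> k \<omega> = X (Suc k) \<omega> - (2 * p - 1) * (S k \<omega> / real k)"

lemma S_Suc: "S (Suc n) \<omega> = S n \<omega> + X (Suc n) \<omega>"
  by (simp add: erw_position_def)

lemma S_history: "k \<le> n \<Longrightarrow> S k \<in> borel_measurable (history n)"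
  unfolding erw_position_def[abs_def] by (intro borel_measurable_sum X_history) auto

lemma \<epsilon>_history: "Suc k \<le> n \<Longrightarrow> \<epsilon> k \<in> borel_measurable (history n)"
  unfolding \<epsilon>_def[abs_def]
  by (intro borel_measurable_diff borel_measurable_times borel_measurable_divide X_history S_history) auto

lemma AE_\<alpha>: "n \<ge> 1 \<Longrightarrow> AE \<omega> in M. \<alpha> n \<omega> = 1 \<or> \<alpha> n \<omega> = -1"
proof -
  assume n: "n \<ge> 1"
  have [measurable]: "\<alpha> n \<in> borel_measurable M" using \<alpha>_measurable[OF n] .
  have "prob ({\<omega> \<in> space M. \<alpha> n \<omega> = 1} \<union> {\<omega> \<in> space M. \<alpha> n \<omega> = -1})
      = prob {\<omega> \<in> space M. \<alpha> n \<omega> = 1} + prob {\<omega> \<in> space M. \<alpha> n \<omega> = -1}"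
    by (rule finite_measure_Union) auto
  then have "prob ({\<omega> \<in> space M. \<alpha> n \<omega> = 1} \<union> {\<omega> \<in> space M. \<alpha> n \<omega> = -1}) = 1"
    using sign[OF n] by simp
  from AE_prob_1[OF this] show ?thesis by eventually_elim auto
qed

lemma AE_\<beta>: "n \<ge> 1 \<Longrightarrow> AE \<omega> in M. \<beta> n \<omega> \<in> {1..n}"
proof -
  assume n: "n \<ge> 1"
  have "AE k in measure_pmf (pmf_of_set {1..n}). k \<in> {1..n}"
    using n by (simp add: AE_measure_pmf_iff)
  then have "AE k in distr M (count_space UNIV) (\<beta> n). k \<in> {1..n}"
    unfolding memory_uniform[OF n] .
  then show ?thesis
    using \<beta>_measurable[OF n] by (simp add: AE_distr_iff)
qed

text \<open>Each later step is a sign times an earlier one. The induction is strong because the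
  remembered time may be any earlier time.\<close>

lemma AE_X: "AE \<omega> in M. \<forall>k\<ge>1. X k \<omega> = 1 \<or> X k \<omega> = -1"
proof -
  have X1: "AE \<omega> in M. X 1 \<omega> = 1 \<or> X 1 \<omega> = -1"
  proof -
    have [measurable]: "X (Suc 0) \<in> borel_measurable M" by (rule X_measurable) simp
    have "prob ({\<omega> \<in> space M. X 1 \<omega> = 1} \<union> {\<omega> \<in> space M. X 1 \<omega> = -1})
        = prob {\<omega> \<in> space M. X 1 \<omega> = 1} + prob {\<omega> \<in> space M. X 1 \<omega> = -1}"
      by (rule finite_measure_Union) auto
    then have "prob ({\<omega> \<in> space M. X 1 \<omega> = 1} \<union> {\<omega> \<in> space M. X 1 \<omega> = -1}) = 1"
      using first_step by simp
    from AE_prob_1[OF this] show ?thesis by eventually_elim auto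
  qed
  \<comment> \<open>The exceptional null sets of all times are removed at once, so that the
    induction can run along one fixed path.\<close>
  have "AE \<omega> in M. \<forall>n\<ge>1. X (Suc n) \<omega> = \<alpha> n \<omega> * X (\<beta> n \<omega>) \<omega> \<and> \<beta> n \<omega> \<in> {1..n} \<and> \<bar>\<alpha> n \<omega>\<bar> = 1"
    unfolding AE_all_countable
  proof (intro allI)
    fix n
    show "AE \<omega> in M. 1 \<le> n \<longrightarrow> X (Suc n) \<omega> = \<alpha> n \<omega> * X (\<beta> n \<omega>) \<omega> \<and> \<beta> n \<omega> \<in> {1..n} \<and> \<bar>\<alpha> n \<omega>\<bar> = 1"
    proof (cases "1 \<le> n")
      case True
      show ?thesis using step[OF True] AE_\<alpha>[OF True] AE_\<beta>[OF True] by eventually_elim auto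
    qed simp
  qed
  with X1 show ?thesis
  proof eventually_elim
    case (elim \<omega>)
    have "k \<ge> 1 \<Longrightarrow> \<bar>X k \<omega>\<bar> = 1" for k
    proof (induction k rule: less_induct)
      case (less k)
      show ?case
      proof (cases "k = 1")
        case True
        then show ?thesis using elim by auto
      next
        case False
        with less.prems obtain m where m: "k = Suc m" "m \<ge> 1" by (cases k) auto
        with elim(2) have "X k \<omega> = \<alpha> m \<omega> * X (\<beta> m \<omega>) \<omega>" "\<beta> m \<omega> \<in> {1..m}" "\<bar>\<alpha> m \<omega>\<bar> = 1" by auto
        with less.IH[of "\<beta> m \<omega>"] m show ?thesis by (auto simp: abs_mult)
      qed
    qed
    then show ?case by (smt (verit))
  qed
qed

lemma AE_bounds:
  "AE \<omega> in M. \<forall>k\<ge>1. \<bar>X k \<omega>\<bar> = 1 \<and> \<bar>S k \<omega> / real k\<bar> \<le> 1 \<and> \<bar>\<epsilon> k \<omega>\<bar> \<le> 2"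
  using AE_X
proof eventually_elim
  case (elim \<omega>)
  show ?case
  proof (intro allI impI)
    fix k :: nat assume k: "k \<ge> 1"
    have X: "\<bar>X i \<omega>\<bar> = 1" if "i \<ge> 1" for i using elim that by fastforce
    have "\<bar>S k \<omega>\<bar> \<le> (\<Sum>i=1..k. \<bar>X i \<omega>\<bar>)" unfolding erw_position_def by (rule sum_abs)
    also have "\<dots> = (\<Sum>i=1..k. 1)" by (rule sum.cong) (auto simp: X)
    finally have S: "\<bar>S k \<omega> / real k\<bar> \<le> 1" using k by (simp add: abs_divide)
    have "\<bar>(2 * p - 1) * (S k \<omega> / real k)\<bar> \<le> 1 * 1"
      unfolding abs_mult using p_range S by (intro mult_mono) auto
    then have "\<bar>\<epsilon> k \<omega>\<bar> \<le> 2" using X[of "Suc k"] unfolding \<epsilon>_def by linarith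
    with S X[OF k] show "\<bar>X k \<omega>\<bar> = 1 \<and> \<bar>S k \<omega> / real k\<bar> \<le> 1 \<and> \<bar>\<epsilon> k \<omega>\<bar> \<le> 2" by blast
  qed
qed

lemma expectation_\<alpha>: "n \<ge> 1 \<Longrightarrow> (\<integral>\<omega>. complex_of_real (\<alpha> n \<omega>) \<partial>M) = complex_of_real (2 * p - 1)"
proof -
  assume n: "n \<ge> 1"
  have [measurable]: "\<alpha> n \<in> borel_measurable M" using \<alpha>_measurable[OF n] .
  have "(\<integral>\<omega>. \<alpha> n \<omega> \<partial>M) = (\<integral>\<omega>. indicator {\<omega> \<in> space M. \<alpha> n \<omega> = 1} \<omega> - indicator {\<omega> \<in> space M. \<alpha> n \<omega> = -1} \<omega> \<partial>M)"
    by (rule integral_cong_AE, simp, simp)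
       (use AE_\<alpha>[OF n] AE_space in \<open>eventually_elim, auto simp: indicator_def\<close>)
  also have "\<dots> = p - (1 - p)"
    by (subst Bochner_Integration.integral_diff) (auto simp: sign[OF n] intro!: integrable_real_indicator simp: less_top[symmetric])
  finally show ?thesis by simp
qed

lemma prob_\<beta>:
  "n \<ge> 1 \<Longrightarrow> j \<in> {1..n} \<Longrightarrow> prob {\<omega> \<in> space M. \<beta> n \<omega> = j} = 1 / real n"
proof -
  assume n: "n \<ge> 1" and j: "j \<in> {1..n}"
  have "prob {\<omega> \<in> space M. \<beta> n \<omega> = j} = measure (distr M (count_space UNIV) (\<beta> n)) {j}"
    by (subst measure_distr[OF \<beta>_measurable[OF n]]) (auto intro!: arg_cong[where f=prob])
  also have "\<dots> = 1 / real n"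
    unfolding memory_uniform[OF n] using n j by (subst measure_pmf_of_set) auto
  finally show ?thesis .
qed

text \<open>Split the step by the remembered time \<open>j\<close>: independence of
  \<open>\<beta> n\<close> from the history contributes \<open>1 / n\<close>, that of
  \<open>\<alpha> n\<close> from the history and \<open>\<beta> n\<close> contributes
  \<open>2 * p - 1\<close>, and summing over \<open>j\<close> restores \<open>S n / n\<close>.
  Testing against bounded \<open>H\<close> takes the place of a conditional expectation;
  \<open>H\<close> is complex because McLeish's product is.\<close>

lemma martingale_difference:
  fixes H :: "'a \<Rightarrow> complex"
  assumes n: "n \<ge> 1" and H: "H \<in> borel_measurable (history n)"
    and bd: "AE \<omega> in M. cmod (H \<omega>) \<le> B"
  shows "(\<integral>\<omega>. H \<omega> * \<epsilon> n \<omega> \<partial>M) = 0"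
proof -
  define \<B> where "\<B> = vimage_algebra (space M) (\<beta> n) (count_space UNIV)"
  define \<A> where "\<A> = vimage_algebra (space M) (\<alpha> n) borel"
  define \<C> where "\<C> = vimage_algebra (space M) (\<lambda>\<omega>. (\<lambda>i\<in>{1..n}. X i \<omega>, \<beta> n \<omega>))
        (Pi\<^sub>M {1..n} (\<lambda>_. borel) \<Otimes>\<^sub>M count_space UNIV)"
  have [measurable]: "\<alpha> n \<in> borel_measurable M" "\<beta> n \<in> measurable M (count_space UNIV)"
    using \<alpha>_measurable[OF n] \<beta>_measurable[OF n] by auto
  have [measurable]: "H \<in> borel_measurable M" using history_measurable[OF H] .
  have XM[measurable]: "X j \<in> borel_measurable M" if "1 \<le> j" for j using X_measurable[OF that] .
  have pair: "(\<lambda>\<omega>. (\<lambda>i\<in>{1..n}. X i \<omega>, \<beta> n \<omega>)) \<in> measurable \<C> (Pi\<^sub>M {1..n} (\<lambda>_. borel) \<Otimes>\<^sub>M count_space UNIV)"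
    unfolding \<C>_def by (rule measurable_vimage_algebra1) (auto simp: space_pair_measure space_PiM)
  \<comment> \<open>The first component of the pair generates \<open>history n\<close>, so whatever
    the history determines is also measurable for \<open>\<C>\<close>.\<close>
  have "(\<lambda>\<omega>. \<omega>) \<in> measurable \<C> (history n)"
    unfolding history_def
    by (rule measurable_vimage_algebra2, simp add: \<C>_def)
       (use measurable_compose[OF pair measurable_fst] in simp)
  then have toC: "f \<in> borel_measurable (history n) \<Longrightarrow> f \<in> borel_measurable \<C>" for f :: "'a \<Rightarrow> complex"
    using measurable_compose by fastforce
  have \<beta>C: "\<beta> n \<in> measurable \<C> (count_space UNIV)"
    using measurable_compose[OF pair measurable_snd] by simp
  have \<beta>B: "\<beta> n \<in> measurable \<B> (count_space UNIV)"
    unfolding \<B>_def by (rule measurable_vimage_algebra1) auto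
  have \<alpha>A: "\<alpha> n \<in> borel_measurable \<A>"
    unfolding \<A>_def by (rule measurable_vimage_algebra1) auto
  have spB: "space \<B> = space M" and spA: "space \<A> = space M" and spC: "space \<C> = space M"
    by (auto simp: \<A>_def \<B>_def \<C>_def)
  have indB: "indep_set (sets (history n)) (sets \<B>)"
    using memory_indep[OF n] unfolding \<B>_def history_def .
  have indA: "indep_set (sets \<C>) (sets \<A>)"
    using sign_indep[OF n] unfolding \<A>_def \<C>_def .
  have HXh: "(\<lambda>\<omega>. H \<omega> * complex_of_real (X j \<omega>)) \<in> borel_measurable (history n)" if "j \<in> {1..n}" for j
    using H X_history[of j n] that by (intro borel_measurable_times borel_measurable_of_real) auto
  have HXb: "AE \<omega> in M. cmod (H \<omega> * complex_of_real (X j \<omega>)) \<le> B" if "j \<in> {1..n}" for j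
    using bd AE_bounds by eventually_elim (use that in \<open>auto simp: norm_mult\<close>)
  have HXint: "integrable M (\<lambda>\<omega>. H \<omega> * complex_of_real (X j \<omega>))" if "j \<in> {1..n}" for j
    by (rule integrable_const_bound[OF HXb[OF that]]) (rule history_measurable[OF HXh[OF that]])
  define I where "I j \<omega> = (if \<beta> n \<omega> = j then 1 else 0 :: complex)" for j \<omega>
  have Imeas: "I j \<in> borel_measurable N" if "\<beta> n \<in> measurable N (count_space UNIV)" for j N
    unfolding I_def[abs_def] using that by measurable
  have [measurable]: "I j \<in> borel_measurable M" for j by (rule Imeas) simp
  have Iint: "integrable M (I j)" for j
    by (rule integrable_const_bound[of _ 1]) (auto simp: I_def)
  have EI: "(\<integral>\<omega>. I j \<omega> \<partial>M) = 1 / of_nat n" if "j \<in> {1..n}" for j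
  proof -
    have "(\<integral>\<omega>. I j \<omega> \<partial>M) = (\<integral>\<omega>. complex_of_real (indicator {\<omega> \<in> space M. \<beta> n \<omega> = j} \<omega>) \<partial>M)"
      by (rule Bochner_Integration.integral_cong) (auto simp: I_def)
    also have "\<dots> = complex_of_real (prob {\<omega> \<in> space M. \<beta> n \<omega> = j})"
      by (subst integral_complex_of_real) simp
    finally show ?thesis using prob_\<beta>[OF n that] by simp
  qed
  have HXI: "(\<integral>\<omega>. H \<omega> * complex_of_real (X j \<omega>) * I j \<omega> \<partial>M) = (\<integral>\<omega>. H \<omega> * complex_of_real (X j \<omega>) \<partial>M) / of_nat n"
    if j: "j \<in> {1..n}" for j
    by (subst indep_set_lebesgue_integral[OF indB space_history spB HXh[OF j] Imeas[OF \<beta>B] HXint[OF j] Iint])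
       (simp add: EI[OF j])
  have HXIint: "integrable M (\<lambda>\<omega>. H \<omega> * complex_of_real (X j \<omega>) * I j \<omega>)" if j: "j \<in> {1..n}" for j
    by (rule Bochner_Integration.integrable_bound[OF HXint[OF j]])
       (use j in \<open>auto simp: I_def\<close>)
  have \<alpha>int: "integrable M (\<lambda>\<omega>. complex_of_real (\<alpha> n \<omega>))"
    by (rule integrable_const_bound[of _ 1]) (use AE_\<alpha>[OF n] in \<open>auto elim!: eventually_mono\<close>)
  have HXI\<alpha>: "(\<integral>\<omega>. H \<omega> * complex_of_real (X j \<omega>) * I j \<omega> * complex_of_real (\<alpha> n \<omega>) \<partial>M)
      = (\<integral>\<omega>. H \<omega> * complex_of_real (X j \<omega>) \<partial>M) / of_nat n * of_real (2 * p - 1)"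
    if j: "j \<in> {1..n}" for j
    by (subst indep_set_lebesgue_integral[OF indA spC spA _ _ HXIint[OF j] \<alpha>int])
       (use \<alpha>A in \<open>auto intro!: borel_measurable_times[OF toC[OF HXh[OF j]] Imeas[OF \<beta>C]] simp: HXI[OF j] expectation_\<alpha>[OF n] simp del: of_real_diff of_real_mult integral_complex_of_real\<close>)
  have HXI\<alpha>int: "integrable M (\<lambda>\<omega>. H \<omega> * complex_of_real (X j \<omega>) * I j \<omega> * complex_of_real (\<alpha> n \<omega>))" if j: "j \<in> {1..n}" for j
    by (rule Bochner_Integration.integrable_bound[OF HXIint[OF j]])
       (use j AE_\<alpha>[OF n] in \<open>auto elim!: eventually_mono simp: norm_mult\<close>)
  have "(\<integral>\<omega>. H \<omega> * complex_of_real (X (Suc n) \<omega>) \<partial>M)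
      = (\<integral>\<omega>. (\<Sum>j\<in>{1..n}. H \<omega> * complex_of_real (X j \<omega>) * I j \<omega> * complex_of_real (\<alpha> n \<omega>)) \<partial>M)"
  proof (rule integral_cong_AE)
    show "(\<lambda>\<omega>. \<Sum>j\<in>{1..n}. H \<omega> * complex_of_real (X j \<omega>) * I j \<omega> * complex_of_real (\<alpha> n \<omega>)) \<in> borel_measurable M"
      by (intro borel_measurable_sum borel_measurable_integrable HXI\<alpha>int)
    show "AE \<omega> in M. H \<omega> * complex_of_real (X (Suc n) \<omega>) = (\<Sum>j\<in>{1..n}. H \<omega> * complex_of_real (X j \<omega>) * I j \<omega> * complex_of_real (\<alpha> n \<omega>))"
      using step[OF n] AE_\<beta>[OF n]
    proof eventually_elim
      case (elim \<omega>)
      have "(\<Sum>j\<in>{1..n}. H \<omega> * complex_of_real (X j \<omega>) * I j \<omega> * complex_of_real (\<alpha> n \<omega>))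
          = (\<Sum>j\<in>{1..n}. if j = \<beta> n \<omega> then H \<omega> * complex_of_real (X j \<omega>) * complex_of_real (\<alpha> n \<omega>) else 0)"
        by (rule sum.cong) (auto simp: I_def)
      then show ?case using elim by simp
    qed
  qed (simp add: XM)
  also have "\<dots> = (\<Sum>j\<in>{1..n}. (\<integral>\<omega>. H \<omega> * complex_of_real (X j \<omega>) \<partial>M) / of_nat n * of_real (2 * p - 1))"
    by (rule trans[OF Bochner_Integration.integral_sum[OF HXI\<alpha>int] sum.cong[OF refl HXI\<alpha>]])
  also have "\<dots> = (\<Sum>j\<in>{1..n}. (\<integral>\<omega>. H \<omega> * complex_of_real (X j \<omega>) \<partial>M)) * (of_real (2 * p - 1) / of_nat n)"
    by (simp add: sum_distrib_right sum_divide_distrib)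
  also have "\<dots> = (\<integral>\<omega>. (\<Sum>j\<in>{1..n}. H \<omega> * complex_of_real (X j \<omega>)) \<partial>M) * (of_real (2 * p - 1) / of_nat n)"
    by (subst Bochner_Integration.integral_sum[OF HXint]) auto
  also have "\<dots> = (\<integral>\<omega>. (\<Sum>j\<in>{1..n}. H \<omega> * complex_of_real (X j \<omega>)) * (of_real (2 * p - 1) / of_nat n) \<partial>M)"
    by simp
  also have "\<dots> = (\<integral>\<omega>. H \<omega> * complex_of_real ((2 * p - 1) * (S n \<omega> / real n)) \<partial>M)"
    by (rule Bochner_Integration.integral_cong)
       (simp_all add: erw_position_def sum_distrib_left sum_distrib_right sum_divide_distrib mult_ac)
  finally have eq: "(\<integral>\<omega>. H \<omega> * complex_of_real (X (Suc n) \<omega>) \<partial>M) = \<dots>" .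
  have "(\<integral>\<omega>. H \<omega> * \<epsilon> n \<omega> \<partial>M) = (\<integral>\<omega>. H \<omega> * complex_of_real (X (Suc n) \<omega>) - H \<omega> * complex_of_real ((2 * p - 1) * (S n \<omega> / real n)) \<partial>M)"
    by (rule Bochner_Integration.integral_cong) (simp_all add: \<epsilon>_def algebra_simps)
  also have "\<dots> = 0"
  proof (subst Bochner_Integration.integral_diff)
    show "integrable M (\<lambda>\<omega>. H \<omega> * complex_of_real (X (Suc n) \<omega>))"
      by (rule integrable_const_bound[of _ B], use bd AE_bounds in eventually_elim)
         (auto simp: norm_mult XM)
    have "AE \<omega> in M. cmod (H \<omega> * complex_of_real ((2 * p - 1) * (S n \<omega> / real n))) \<le> B"
      using bd AE_bounds
    proof eventually_elim
      case (elim \<omega>)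
      have "cmod (H \<omega>) * (\<bar>2 * p - 1\<bar> * \<bar>S n \<omega> / real n\<bar>) \<le> B * (1 * 1)"
        using elim n p_range by (intro mult_mono) (auto intro: order_trans[OF norm_ge_zero])
      then show ?case by (simp add: norm_mult abs_mult del: of_real_mult of_real_divide)
    qed
    then show "integrable M (\<lambda>\<omega>. H \<omega> * complex_of_real ((2 * p - 1) * (S n \<omega> / real n)))"
      by (rule integrable_const_bound)
         (use history_measurable[OF S_history[OF order_refl[of n]]] in measurable)
  qed (simp add: eq)
  finally show ?thesis .
qed

lemma martingale_difference_real:
  fixes H :: "'a \<Rightarrow> real"
  assumes n: "n \<ge> 1" and H: "H \<in> borel_measurable (history n)"
    and bd: "AE \<omega> in M. \<bar>H \<omega>\<bar> \<le> B"
  shows "(\<integral>\<omega>. H \<omega> * \<epsilon> n \<omega> \<partial>M) = 0"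
proof -
  have "(\<integral>\<omega>. complex_of_real (H \<omega>) * \<epsilon> n \<omega> \<partial>M) = 0"
    by (rule martingale_difference[OF n, where B=B]) (use H bd in auto)
  then have "complex_of_real (\<integral>\<omega>. H \<omega> * \<epsilon> n \<omega> \<partial>M) = 0"
    by (subst integral_complex_of_real[symmetric]) simp
  then show ?thesis by simp
qed

subsection \<open>Moments and non-degeneracy of the limit\<close>

lemma X_borel [measurable]: "X (Suc k) \<in> borel_measurable M"
  using X_measurable[of "Suc k"] by simp

lemma S_borel [measurable]: "S k \<in> borel_measurable M"
  using history_measurable[OF S_history[OF order_refl]] .

lemma \<epsilon>_borel [measurable]: "\<epsilon> k \<in> borel_measurable M"
  using history_measurable[OF \<epsilon>_history[OF order_refl]] .

lemma AE_S_le: "AE \<omega> in M. \<bar>S n \<omega>\<bar> \<le> real n"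
proof (cases "n \<ge> 1")
  case True
  show ?thesis using AE_bounds by eventually_elim (use True in \<open>auto simp: abs_divide divide_le_eq\<close>)
qed (simp add: erw_position_def)

lemma integrable_S_sq: "integrable M (\<lambda>\<omega>. (S n \<omega>)\<^sup>2)"
  by (rule integrable_const_bound[of _ "(real n)\<^sup>2"])
     (use AE_S_le[of n] in \<open>auto elim!: eventually_mono intro!: power2_le_iff_abs_le[THEN iffD2]\<close>)

text \<open>In the expanded square, \<open>S n * \<epsilon> n\<close> has mean zero, so the cross
  term contributes only through the conditional mean of the step; the squared step contributes
  one.\<close>

lemma expectation_S_sq_Suc:
  assumes n: "n \<ge> 1"
  shows "(\<integral>\<omega>. (S (Suc n) \<omega>)\<^sup>2 \<partial>M) = (1 + 2 * (2 * p - 1) / real n) * (\<integral>\<omega>. (S n \<omega>)\<^sup>2 \<partial>M) + 1"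
proof -
  have z: "(\<integral>\<omega>. S n \<omega> * \<epsilon> n \<omega> \<partial>M) = 0"
    by (rule martingale_difference_real[OF n S_history[OF order_refl] AE_S_le])
  have i: "integrable M (\<lambda>\<omega>. S n \<omega> * \<epsilon> n \<omega>)"
  proof (rule integrable_const_bound[of _ "real n * 2"])
    show "AE \<omega> in M. norm (S n \<omega> * \<epsilon> n \<omega>) \<le> real n * 2"
      using AE_S_le[of n] AE_bounds
      by eventually_elim (use n in \<open>auto simp: abs_mult intro!: mult_mono\<close>)
  qed simp
  have "(\<integral>\<omega>. (S (Suc n) \<omega>)\<^sup>2 \<partial>M)
      = (\<integral>\<omega>. (1 + 2 * (2 * p - 1) / real n) * (S n \<omega>)\<^sup>2 + 2 * (S n \<omega> * \<epsilon> n \<omega>) + 1 \<partial>M)"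
  proof (rule integral_cong_AE)
    show "AE \<omega> in M. (S (Suc n) \<omega>)\<^sup>2 = (1 + 2 * (2 * p - 1) / real n) * (S n \<omega>)\<^sup>2 + 2 * (S n \<omega> * \<epsilon> n \<omega>) + 1"
      using AE_bounds
    proof eventually_elim
      case (elim \<omega>)
      then have "\<bar>X (Suc n) \<omega>\<bar> = 1" by auto
      then have "(X (Suc n) \<omega>)\<^sup>2 = 1" by (metis power2_abs power_one)
      moreover have "(S (Suc n) \<omega>)\<^sup>2 = (S n \<omega>)\<^sup>2 + 2 * (S n \<omega> * X (Suc n) \<omega>) + (X (Suc n) \<omega>)\<^sup>2"
        by (simp add: S_Suc power2_sum)
      ultimately show ?case using n by (simp add: \<epsilon>_def field_simps power2_eq_square)
    qed
  qed measurable
  also have "\<dots> = (1 + 2 * (2 * p - 1) / real n) * (\<integral>\<omega>. (S n \<omega>)\<^sup>2 \<partial>M) + 2 * (\<integral>\<omega>. S n \<omega> * \<epsilon> n \<omega> \<partial>M) + 1"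
    using i integrable_S_sq[of n] by (simp add: prob_space)
  finally show ?thesis using z by simp
qed

text \<open>The linear correction term absorbs the additive constant of the recursion.\<close>

lemma expectation_S_sq_le:
  assumes p: "3/4 < p" and n: "n \<ge> 1"
  defines "D \<equiv> 1 / (4 * p - 3)"
  shows "(\<integral>\<omega>. (S n \<omega>)\<^sup>2 \<partial>M) \<le> (1 + D) * real n powr (2 * (2 * p - 1)) - D * real n"
  using n
proof (induction n rule: nat_induct_at_least)
  case base
  have "(\<integral>\<omega>. (S 1 \<omega>)\<^sup>2 \<partial>M) = (\<integral>\<omega>. 1 \<partial>M)"
  proof (rule integral_cong_AE)
    show "AE \<omega> in M. (S 1 \<omega>)\<^sup>2 = 1"
      using AE_X by eventually_elim (auto simp: erw_position_def power2_eq_square)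
  qed auto
  then show ?case by (simp add: prob_space)
next
  case (Suc n)
  define a where "a = 2 * (2 * p - 1)"
  \<comment> \<open>This value of \<open>D\<close> turns the constants \<open>- D * a + 1\<close>
    left by the recursion into \<open>- D\<close>, exactly what the linear correction needs to pass
    from \<open>n\<close> to \<open>Suc n\<close>.\<close>
  have D: "0 < D" "D * (a - 1) = 1" using p by (auto simp: D_def a_def field_simps)
  have a: "1 \<le> a" using p by (simp add: a_def)
  have n: "0 < real n" using Suc by simp
  have "(\<integral>\<omega>. (S (Suc n) \<omega>)\<^sup>2 \<partial>M) = (1 + a * (1 / real n)) * (\<integral>\<omega>. (S n \<omega>)\<^sup>2 \<partial>M) + 1"
    using expectation_S_sq_Suc[OF Suc(1)] by (simp add: a_def)
  also have "\<dots> \<le> (1 + a * (1 / real n)) * ((1 + D) * real n powr a - D * real n) + 1"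
    using Suc.IH a n unfolding a_def[symmetric] by (intro add_mono mult_left_mono) auto
  also have "\<dots> = (1 + D) * ((1 + a * (1 / real n)) * real n powr a) - D * real n - D * a + 1"
    using n by (simp add: field_simps)
  \<comment> \<open>Bernoulli's inequality for exponents at least one absorbs the factor into a
    power of \<open>Suc n\<close>.\<close>
  also have "(1 + a * (1 / real n)) * real n powr a \<le> (1 + 1 / real n) powr a * real n powr a"
    using n a by (intro mult_right_mono one_plus_powr_ge) auto
  also have "\<dots> = ((1 + 1 / real n) * real n) powr a"
    using n by (subst powr_mult) auto
  also have "(1 + 1 / real n) * real n = real (Suc n)" using n by (simp add: field_simps)
  finally have "(\<integral>\<omega>. (S (Suc n) \<omega>)\<^sup>2 \<partial>M) \<le> (1 + D) * real (Suc n) powr a - D * real n - D * a + 1"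
    using D by (simp add: mult_left_mono)
  also have "\<dots> = (1 + D) * real (Suc n) powr a - D * real (Suc n)"
    using D by (simp add: algebra_simps)
  finally show ?case unfolding a_def .
qed

text \<open>With \<open>a = 2 * p - 1\<close>, each step multiplies the mean by
  \<open>1 + a / n\<close>, which dominates \<open>(1 + 1 / n) powr a\<close>. Weighting with the
  first step gives a bound for every \<open>q\<close>, whereas the mean of \<open>S n\<close> itself
  vanishes for \<open>q = 1/2\<close>.\<close>

lemma expectation_X1_S_ge:
  assumes p: "1/2 \<le> p" and n: "n \<ge> 1"
  shows "real n powr (2 * p - 1) \<le> (\<integral>\<omega>. X 1 \<omega> * S n \<omega> \<partial>M)"
  using n
proof (induction n rule: nat_induct_at_least)
  case base
  have "(\<integral>\<omega>. X 1 \<omega> * S 1 \<omega> \<partial>M) = (\<integral>\<omega>. 1 \<partial>M)"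
  proof (rule integral_cong_AE)
    show "AE \<omega> in M. X 1 \<omega> * S 1 \<omega> = 1"
      using AE_X by eventually_elim (auto simp: erw_position_def)
  qed auto
  then show ?case by (simp add: prob_space)
next
  case (Suc n)
  define a where "a = 2 * p - 1"
  have a: "0 \<le> a" "a \<le> 1" using p p_range by (auto simp: a_def)
  have n: "0 < real n" using Suc by simp
  have X1: "AE \<omega> in M. \<bar>X 1 \<omega>\<bar> \<le> 1" using AE_bounds by eventually_elim auto
  have z: "(\<integral>\<omega>. X 1 \<omega> * \<epsilon> n \<omega> \<partial>M) = 0"
    by (rule martingale_difference_real[OF Suc(1) X_history X1]) (use Suc in auto)
  have i1: "integrable M (\<lambda>\<omega>. X 1 \<omega> * \<epsilon> n \<omega>)"
  proof (rule integrable_const_bound[of _ "1 * 2"])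
    show "AE \<omega> in M. norm (X 1 \<omega> * \<epsilon> n \<omega>) \<le> 1 * 2"
      using AE_bounds unfolding real_norm_def abs_mult
      by eventually_elim (use Suc in \<open>intro mult_mono, auto\<close>)
  qed simp
  have i2: "integrable M (\<lambda>\<omega>. X 1 \<omega> * S n \<omega>)"
  proof (rule integrable_const_bound[of _ "1 * real n"])
    show "AE \<omega> in M. norm (X 1 \<omega> * S n \<omega>) \<le> 1 * real n"
      using AE_bounds AE_S_le[of n] unfolding real_norm_def abs_mult
      by eventually_elim (intro mult_mono, auto)
  qed simp
  have "(\<integral>\<omega>. X 1 \<omega> * S (Suc n) \<omega> \<partial>M) = (\<integral>\<omega>. (1 + a * (1 / real n)) * (X 1 \<omega> * S n \<omega>) + X 1 \<omega> * \<epsilon> n \<omega> \<partial>M)"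
    by (rule Bochner_Integration.integral_cong[OF refl])
       (simp add: S_Suc \<epsilon>_def a_def field_simps add_divide_distrib diff_divide_distrib)
  also have "\<dots> = (1 + a * (1 / real n)) * (\<integral>\<omega>. X 1 \<omega> * S n \<omega> \<partial>M)"
    using i1 i2 z by simp
  finally have eq: "(\<integral>\<omega>. X 1 \<omega> * S (Suc n) \<omega> \<partial>M) = \<dots>" .
  have "(1 + 1 / real n) * real n = real (Suc n)" using n by (simp add: field_simps)
  then have "real (Suc n) powr a = ((1 + 1 / real n) * real n) powr a" by simp
  also have "\<dots> = (1 + 1 / real n) powr a * real n powr a"
    using n by (subst powr_mult) auto
  also have "\<dots> \<le> (1 + a * (1 / real n)) * (\<integral>\<omega>. X 1 \<omega> * S n \<omega> \<partial>M)"
    using Suc.IH n a unfolding a_def[symmetric] by (intro mult_mono one_plus_powr_le) auto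
  finally show ?case unfolding eq a_def .
qed

text \<open>If \<open>L\<close> vanished almost surely, the means of \<open>\<bar>Y n\<bar>\<close>
  truncated at \<open>K\<close> would tend to zero, while the second moment bound makes the part
  beyond \<open>K\<close> contribute at most 1/2. This contradicts that \<open>X 1 * Y n\<close> has
  mean at least one.\<close>

lemma prob_limit_nonzero:
  assumes p: "3/4 < p" and [measurable]: "L \<in> borel_measurable M"
    and lim: "AE \<omega> in M. (\<lambda>n. S n \<omega> / real n powr (2 * p - 1)) \<longlonglongrightarrow> L \<omega>"
  shows "prob {\<omega> \<in> space M. (L \<omega>)\<^sup>2 > 0} \<noteq> 0"
proof
  assume "prob {\<omega> \<in> space M. (L \<omega>)\<^sup>2 > 0} = 0"
  then have "emeasure M {\<omega> \<in> space M. (L \<omega>)\<^sup>2 > 0} = 0" by (simp add: emeasure_eq_measure)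
  then have "AE \<omega> in M. \<not> (L \<omega>)\<^sup>2 > 0"
    by (subst AE_iff_measurable[OF _ refl]) simp_all
  then have L0: "AE \<omega> in M. L \<omega> = 0" by eventually_elim simp
  \<comment> \<open>Twice the bound on the second moments of \<open>Y n\<close>, so that the mean of
    \<open>(Y n)\<^sup>2 / K\<close> is at most 1/2.\<close>
  define K where "K = 2 * (1 + 1 / (4 * p - 3))"
  have K: "0 < K" using p by (simp add: K_def add_pos_pos)
  define Y where "Y n \<omega> = S n \<omega> / real n powr (2 * p - 1)" for n \<omega>
  have [measurable]: "Y n \<in> borel_measurable M" for n unfolding Y_def[abs_def] by measurable
  have "(\<lambda>n. \<integral>\<omega>. min \<bar>Y n \<omega>\<bar> K \<partial>M) \<longlonglongrightarrow> (\<integral>\<omega>. 0 \<partial>M)"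
  proof (rule integral_dominated_convergence[where w="\<lambda>_. K"])
    show "AE \<omega> in M. (\<lambda>n. min \<bar>Y n \<omega>\<bar> K) \<longlonglongrightarrow> 0"
      using L0 lim
    proof eventually_elim
      case (elim \<omega>)
      then have "(\<lambda>n. Y n \<omega>) \<longlonglongrightarrow> 0" by (simp add: Y_def)
      then have "(\<lambda>n. min \<bar>Y n \<omega>\<bar> K) \<longlonglongrightarrow> min \<bar>0\<bar> K" by (intro tendsto_intros)
      then show ?case using K by simp
    qed
  qed (use K in auto)
  then have "\<forall>\<^sub>F n in sequentially. (\<integral>\<omega>. min \<bar>Y n \<omega>\<bar> K \<partial>M) < 1/2"
    by (intro order_tendstoD(2)[where y=0]) auto
  then have "\<forall>\<^sub>F n in sequentially. False"
    using eventually_ge_at_top[of 1]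
  proof eventually_elim
    case (elim n)
    define b where "b = real n powr (2 * p - 1)"
    have b: "0 < b" using elim by (simp add: b_def)
    have b2: "b\<^sup>2 = real n powr (2 * (2 * p - 1))"
      using powr_add[of "real n" "2 * p - 1" "2 * p - 1"] by (simp add: b_def power2_eq_square)
    have iY2: "integrable M (\<lambda>\<omega>. (Y n \<omega>)\<^sup>2)"
      using integrable_S_sq[of n] by (simp add: Y_def power_divide)
    have im: "integrable M (\<lambda>\<omega>. min \<bar>Y n \<omega>\<bar> K)"
      by (rule integrable_const_bound[of _ K]) (use K in auto)
    have "(\<integral>\<omega>. (Y n \<omega>)\<^sup>2 \<partial>M) = (\<integral>\<omega>. (S n \<omega>)\<^sup>2 \<partial>M) / b\<^sup>2"
      by (simp add: Y_def power_divide b_def)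
    also have "\<dots> \<le> (K / 2 * b\<^sup>2) / b\<^sup>2"
    proof (rule divide_right_mono)
      have "(\<integral>\<omega>. (S n \<omega>)\<^sup>2 \<partial>M) \<le> K / 2 * b\<^sup>2 - 1 / (4 * p - 3) * real n"
        using expectation_S_sq_le[OF p elim(2)] unfolding b2 K_def by (simp only: nonzero_mult_div_cancel_left)
      also have "\<dots> \<le> K / 2 * b\<^sup>2" using p by simp
      finally show "(\<integral>\<omega>. (S n \<omega>)\<^sup>2 \<partial>M) \<le> K / 2 * b\<^sup>2" .
    qed simp
    finally have Y2: "(\<integral>\<omega>. (Y n \<omega>)\<^sup>2 \<partial>M) \<le> K / 2" using b by simp
    have "1 \<le> (\<integral>\<omega>. X 1 \<omega> * S n \<omega> \<partial>M) / b"
      using expectation_X1_S_ge[of n] elim p b unfolding b_def by simp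
    also have "\<dots> = (\<integral>\<omega>. X 1 \<omega> * Y n \<omega> \<partial>M)" by (simp add: Y_def b_def)
    \<comment> \<open>The first step has modulus one, and beyond \<open>K\<close> a modulus is at
      most its square divided by \<open>K\<close>.\<close>
    also have "\<dots> \<le> (\<integral>\<omega>. min \<bar>Y n \<omega>\<bar> K + (Y n \<omega>)\<^sup>2 / K \<partial>M)"
    proof (rule integral_mono_AE')
      show "integrable M (\<lambda>\<omega>. min \<bar>Y n \<omega>\<bar> K + (Y n \<omega>)\<^sup>2 / K)" using iY2 im by simp
      show "AE \<omega> in M. X 1 \<omega> * Y n \<omega> \<le> min \<bar>Y n \<omega>\<bar> K + (Y n \<omega>)\<^sup>2 / K"
        using AE_bounds
      proof eventually_elim
        case (elim \<omega>)
        have "X 1 \<omega> * Y n \<omega> \<le> \<bar>X 1 \<omega> * Y n \<omega>\<bar>" by simp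
        also have "\<dots> = \<bar>Y n \<omega>\<bar>" using elim by (simp add: abs_mult)
        also have "\<dots> \<le> min \<bar>Y n \<omega>\<bar> K + (Y n \<omega>)\<^sup>2 / K"
        proof (cases "\<bar>Y n \<omega>\<bar> \<le> K")
          case False
          then have "\<bar>Y n \<omega>\<bar> * K \<le> \<bar>Y n \<omega>\<bar> * \<bar>Y n \<omega>\<bar>" by (intro mult_left_mono) auto
          then have "\<bar>Y n \<omega>\<bar> \<le> (Y n \<omega>)\<^sup>2 / K"
            using K by (simp add: le_divide_eq power2_eq_square)
          then show ?thesis using K by simp
        qed (use K in simp)
        finally show ?case .
      qed
      show "AE \<omega> in M. 0 \<le> min \<bar>Y n \<omega>\<bar> K + (Y n \<omega>)\<^sup>2 / K" using K by simp
    qed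
    also have "\<dots> = (\<integral>\<omega>. min \<bar>Y n \<omega>\<bar> K \<partial>M) + (\<integral>\<omega>. (Y n \<omega>)\<^sup>2 \<partial>M) / K"
      using iY2 im by simp
    also have "\<dots> < 1/2 + 1/2"
      using elim(1) Y2 K by (intro add_less_le_mono) (auto simp: divide_le_eq)
    finally show False by simp
  qed
  then show False by simp
qed

subsection \<open>Martingale transforms\<close>

lemma McLeish_product_history:
  fixes c :: "nat \<Rightarrow> 'a \<Rightarrow> real" and Z :: "'a \<Rightarrow> real"
  assumes "1 \<le> m" "m \<le> n" and c: "\<And>k. m \<le> k \<Longrightarrow> c k \<in> borel_measurable (history k)"
    and Z: "Z \<in> borel_measurable (history m)"
  shows "(\<lambda>\<omega>. Z \<omega> * (\<Prod>k=m..<n. 1 + \<i> * complex_of_real (c k \<omega> * \<epsilon> k \<omega>))) \<in> borel_measurable (history n)"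
proof -
  have "(\<lambda>\<omega>. c k \<omega> * \<epsilon> k \<omega>) \<in> borel_measurable (history n)" if "k \<in> {m..<n}" for k
    using history_mono[of k n, OF _ c[of k]] \<epsilon>_history[of k n] that by (intro borel_measurable_times) auto
  then show ?thesis
    using history_mono[OF assms(2) Z]
    by (intro borel_measurable_times borel_measurable_prod borel_measurable_add borel_measurable_const borel_measurable_of_real) (auto simp del: of_real_mult)
qed

text \<open>Since \<open>c n\<close> is known at time \<open>n\<close>, the factor containing
  \<open>\<epsilon> n\<close> has conditional mean one given the history. Such factors are removed
  one at a time, starting with the last; \<open>Z\<close> depends on the first \<open>m\<close>
  steps only and is unaffected.\<close>

lemma expectation_McLeish_product:
  fixes c :: "nat \<Rightarrow> 'a \<Rightarrow> real" and Z :: "'a \<Rightarrow> real"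
  assumes m: "1 \<le> m" "m \<le> n" and c: "\<And>k. m \<le> k \<Longrightarrow> c k \<in> borel_measurable (history k)"
    and cb: "\<And>k \<omega>. m \<le> k \<Longrightarrow> \<bar>c k \<omega>\<bar> \<le> C"
    and Z: "Z \<in> borel_measurable (history m)" and Zb: "\<And>\<omega>. \<bar>Z \<omega>\<bar> \<le> 1"
  shows "(\<integral>\<omega>. Z \<omega> * (\<Prod>k=m..<n. 1 + \<i> * complex_of_real (c k \<omega> * \<epsilon> k \<omega>)) \<partial>M) = (\<integral>\<omega>. Z \<omega> \<partial>M)"
  using m(2)
proof (induction n rule: nat_induct_at_least)
  case (Suc n)
  have C: "0 \<le> C" by (rule order_trans[OF abs_ge_zero cb[OF order_refl]])
  \<comment> \<open>The product without its last factor. That factor adds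
    \<open>\<i> * c n * H * \<epsilon> n\<close>, in which the coefficient of
    \<open>\<epsilon> n\<close> is bounded and known at time \<open>n\<close>.\<close>
  define H where "H \<omega> = Z \<omega> * (\<Prod>k=m..<n. 1 + \<i> * complex_of_real (c k \<omega> * \<epsilon> k \<omega>))" for \<omega>
  have H: "H \<in> borel_measurable (history n)"
    unfolding H_def[abs_def] by (rule McLeish_product_history[OF m(1) Suc(1) c Z])
  have Hb: "AE \<omega> in M. cmod (H \<omega>) \<le> (1 + C * 2) ^ (n - m)"
    using AE_bounds
  proof eventually_elim
    case (elim \<omega>)
    have "cmod (1 + \<i> * complex_of_real (c k \<omega> * \<epsilon> k \<omega>)) \<le> 1 + C * 2" if "k \<in> {m..<n}" for k
    proof -
      have "\<bar>c k \<omega> * \<epsilon> k \<omega>\<bar> \<le> C * 2"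
        unfolding abs_mult using cb[of k \<omega>] elim that m C by (intro mult_mono) auto
      then show ?thesis
        using norm_triangle_ineq[of 1 "\<i> * complex_of_real (c k \<omega> * \<epsilon> k \<omega>)"]
        by (simp add: norm_mult del: of_real_mult)
    qed
    then have "(\<Prod>k=m..<n. cmod (1 + \<i> * complex_of_real (c k \<omega> * \<epsilon> k \<omega>))) \<le> (\<Prod>k=m..<n. 1 + C * 2)"
      by (intro prod_mono) auto
    then have "cmod (H \<omega>) \<le> 1 * (\<Prod>k=m..<n. 1 + C * 2)"
      unfolding H_def norm_mult prod_norm[symmetric]
      using Zb[of \<omega>] by (intro mult_mono) (auto intro: prod_nonneg)
    then show ?case by simp
  qed
  have Hint: "integrable M H"
    by (rule integrable_const_bound[OF Hb history_measurable[OF H]])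
  have cH: "(\<lambda>\<omega>. \<i> * complex_of_real (c n \<omega>) * H \<omega>) \<in> borel_measurable (history n)"
    using H c[OF Suc(1)] by measurable
  have cHb: "AE \<omega> in M. cmod (\<i> * complex_of_real (c n \<omega>) * H \<omega>) \<le> C * (1 + C * 2) ^ (n - m)"
    using Hb by eventually_elim (use cb[OF Suc(1)] C in \<open>auto simp: norm_mult intro!: mult_mono\<close>)
  have z: "(\<integral>\<omega>. \<i> * complex_of_real (c n \<omega>) * H \<omega> * \<epsilon> n \<omega> \<partial>M) = 0"
    by (rule martingale_difference[OF _ cH cHb]) (use Suc m in simp)
  have i: "integrable M (\<lambda>\<omega>. \<i> * complex_of_real (c n \<omega>) * H \<omega> * \<epsilon> n \<omega>)"
  proof (rule integrable_const_bound[of _ "C * (1 + C * 2) ^ (n - m) * 2"])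
    show "AE \<omega> in M. cmod (\<i> * complex_of_real (c n \<omega>) * H \<omega> * \<epsilon> n \<omega>) \<le> C * (1 + C * 2) ^ (n - m) * 2"
      using cHb AE_bounds
      by eventually_elim (subst norm_mult, intro mult_mono, use Suc m C in auto)
  qed (use history_measurable[OF cH] in measurable)
  have "(\<integral>\<omega>. Z \<omega> * (\<Prod>k=m..<Suc n. 1 + \<i> * complex_of_real (c k \<omega> * \<epsilon> k \<omega>)) \<partial>M)
      = (\<integral>\<omega>. H \<omega> + \<i> * complex_of_real (c n \<omega>) * H \<omega> * \<epsilon> n \<omega> \<partial>M)"
    by (rule Bochner_Integration.integral_cong[OF refl])
       (use Suc(1) in \<open>simp add: H_def prod.atLeastLessThan_Suc algebra_simps\<close>)
  also have "\<dots> = (\<integral>\<omega>. H \<omega> \<partial>M)"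
    using Hint i z by simp
  finally show ?case using Suc.IH unfolding H_def by simp
qed simp

text \<open>The increments are orthogonal: the cross term \<open>c n * T n * \<epsilon> n\<close>
  has mean zero. The factor 4 is the square of the bound on \<open>\<epsilon> k\<close>.\<close>

lemma martingale_transform_sq_le:
  fixes c :: "nat \<Rightarrow> 'a \<Rightarrow> real" and d :: "nat \<Rightarrow> real"
  assumes m: "1 \<le> m" and c: "\<And>k. m \<le> k \<Longrightarrow> c k \<in> borel_measurable (history k)"
    and cb: "\<And>k \<omega>. m \<le> k \<Longrightarrow> \<bar>c k \<omega>\<bar> \<le> d k"
  shows "integrable M (\<lambda>\<omega>. (\<Sum>k=m..<n. c k \<omega> * \<epsilon> k \<omega>)\<^sup>2)" (is "?I n")
    and "(\<integral>\<omega>. (\<Sum>k=m..<n. c k \<omega> * \<epsilon> k \<omega>)\<^sup>2 \<partial>M) \<le> 4 * (\<Sum>k=m..<n. (d k)\<^sup>2)" (is "?E n")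
proof -
  define T where "T n \<omega> = (\<Sum>k=m..<n. c k \<omega> * \<epsilon> k \<omega>)" for n \<omega>
  have T: "T n \<in> borel_measurable (history n)" if "m \<le> n" for n
  proof -
    have "(\<lambda>\<omega>. c k \<omega> * \<epsilon> k \<omega>) \<in> borel_measurable (history n)" if "k \<in> {m..<n}" for k
      using history_mono[of k n, OF _ c[of k]] \<epsilon>_history[of k n] that by (intro borel_measurable_times) auto
    then show ?thesis unfolding T_def[abs_def] by (rule borel_measurable_sum)
  qed
  have d: "0 \<le> d k" if "m \<le> k" for k by (rule order_trans[OF abs_ge_zero cb[OF that]])
  have c\<epsilon>: "AE \<omega> in M. \<forall>k\<ge>m. \<bar>c k \<omega> * \<epsilon> k \<omega>\<bar> \<le> d k * 2"
    using AE_bounds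
  proof eventually_elim
    case (elim \<omega>)
    show ?case
    proof (intro allI impI)
      fix k assume k: "m \<le> k"
      then show "\<bar>c k \<omega> * \<epsilon> k \<omega>\<bar> \<le> d k * 2"
        unfolding abs_mult using elim m cb[OF k] d[OF k] by (intro mult_mono) auto
    qed
  qed
  have Tb: "AE \<omega> in M. \<bar>T n \<omega>\<bar> \<le> (\<Sum>k=m..<n. d k * 2)" for n
    using c\<epsilon> unfolding T_def
    by eventually_elim (rule order_trans[OF sum_abs sum_mono], auto)
  have [measurable]: "c k \<in> borel_measurable M" if "m \<le> k" for k using history_measurable[OF c[OF that]] .
  have I: "?I n" for n
    unfolding T_def[symmetric]
  proof (rule integrable_const_bound[of _ "(\<Sum>k=m..<n. d k * 2)\<^sup>2"])
    show "AE \<omega> in M. norm ((T n \<omega>)\<^sup>2) \<le> (\<Sum>k=m..<n. d k * 2)\<^sup>2"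
      using Tb[of n]
    proof eventually_elim
      case (elim \<omega>)
      then have "\<bar>T n \<omega>\<bar>\<^sup>2 \<le> (\<Sum>k=m..<n. d k * 2)\<^sup>2" by (intro power_mono) auto
      then show ?case by simp
    qed
    show "(\<lambda>\<omega>. (T n \<omega>)\<^sup>2) \<in> borel_measurable M"
      unfolding T_def by measurable
  qed
  have E: "?E n" if "m \<le> n" for n
    using that
  proof (induction n rule: nat_induct_at_least)
    case (Suc n)
    have [measurable]: "T n \<in> borel_measurable M" "c n \<in> borel_measurable M"
      using history_measurable[OF T[OF Suc(1)]] history_measurable[OF c[OF Suc(1)]] .
    have cT: "(\<lambda>\<omega>. c n \<omega> * T n \<omega>) \<in> borel_measurable (history n)"
      using T[OF Suc(1)] c[OF Suc(1)] by measurable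
    have cTb: "AE \<omega> in M. \<bar>c n \<omega> * T n \<omega>\<bar> \<le> d n * (\<Sum>k=m..<n. d k * 2)"
      using Tb[of n] unfolding abs_mult
      by eventually_elim (use cb[OF Suc(1)] d[OF Suc(1)] in \<open>intro mult_mono, auto\<close>)
    have z: "(\<integral>\<omega>. c n \<omega> * T n \<omega> * \<epsilon> n \<omega> \<partial>M) = 0"
      by (rule martingale_difference_real[OF _ cT cTb]) (use Suc m in simp)
    have i1: "integrable M (\<lambda>\<omega>. c n \<omega> * T n \<omega> * \<epsilon> n \<omega>)"
    proof (rule integrable_const_bound[of _ "d n * (\<Sum>k=m..<n. d k * 2) * 2"])
      show "AE \<omega> in M. norm (c n \<omega> * T n \<omega> * \<epsilon> n \<omega>) \<le> d n * (\<Sum>k=m..<n. d k * 2) * 2"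
        using cTb AE_bounds
      proof eventually_elim
        case (elim \<omega>)
        show ?case unfolding real_norm_def abs_mult[of "c n \<omega> * T n \<omega>"]
          using elim Suc m by (intro mult_mono) (auto intro: order_trans[OF abs_ge_zero elim(1)])
      qed
    qed measurable
    have c2: "AE \<omega> in M. (c n \<omega> * \<epsilon> n \<omega>)\<^sup>2 \<le> 4 * (d n)\<^sup>2"
      using c\<epsilon>
    proof eventually_elim
      case (elim \<omega>)
      then have "\<bar>c n \<omega> * \<epsilon> n \<omega>\<bar>\<^sup>2 \<le> (d n * 2)\<^sup>2" using Suc(1) by (intro power_mono) auto
      then show ?case by (simp add: power_mult_distrib)
    qed
    have i2: "integrable M (\<lambda>\<omega>. (c n \<omega> * \<epsilon> n \<omega>)\<^sup>2)"
      by (rule integrable_const_bound[of _ "4 * (d n)\<^sup>2"]) (use c2 in auto)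
    have "(\<integral>\<omega>. (T (Suc n) \<omega>)\<^sup>2 \<partial>M) = (\<integral>\<omega>. (T n \<omega>)\<^sup>2 + 2 * (c n \<omega> * T n \<omega> * \<epsilon> n \<omega>) + (c n \<omega> * \<epsilon> n \<omega>)\<^sup>2 \<partial>M)"
      by (rule Bochner_Integration.integral_cong[OF refl])
         (use Suc(1) in \<open>simp add: T_def power2_sum\<close>)
    also have "\<dots> = (\<integral>\<omega>. (T n \<omega>)\<^sup>2 \<partial>M) + (\<integral>\<omega>. (c n \<omega> * \<epsilon> n \<omega>)\<^sup>2 \<partial>M)"
      using I[of n, folded T_def] i1 i2 z by simp
    also have "(\<integral>\<omega>. (c n \<omega> * \<epsilon> n \<omega>)\<^sup>2 \<partial>M) \<le> (\<integral>\<omega>. 4 * (d n)\<^sup>2 \<partial>M)"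
      by (rule integral_mono_AE[OF i2 _ c2]) simp
    also have "\<dots> = 4 * (d n)\<^sup>2" by (simp add: prob_space)
    finally show ?case
      using Suc.IH Suc(1) unfolding T_def by simp
  qed simp
  show "?I n" by (rule I)
  show "?E n" using E[of n] by (cases "m \<le> n") auto
qed

subsection \<open>Limits of characteristic functions\<close>

definition scaled :: "nat \<Rightarrow> 'a \<Rightarrow> real" where
  "scaled k \<omega> = S k \<omega> / real k powr (2 * p - 1)"

text \<open>The exponent keeps the form \<open>a - 1\<close> of \<open>superdiffusive_path\<close>
  at \<open>a = 2 * p - 1\<close>.\<close>

abbreviation "weight k \<equiv> real k powr (2 * p - 1 - 1)"
abbreviation "total_weight \<equiv> weight_sum (2 * p - 1)"

lemma scaled_weight: "1 \<le> k \<Longrightarrow> scaled k \<omega> * weight k = S k \<omega> / real k"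
  by (simp add: scaled_def powr_diff power2_eq_square)

lemma scaled_history: "k \<le> n \<Longrightarrow> scaled k \<in> borel_measurable (history n)"
  unfolding scaled_def[abs_def] by (intro borel_measurable_divide S_history) auto

lemma scaled_borel [measurable]: "scaled k \<in> borel_measurable M"
  using history_measurable[OF scaled_history[OF order_refl]] .

text \<open>The point to check is that \<open>(\<epsilon> k)\<^sup>2\<close> tends to one. For
  \<open>p < 1\<close> the weights tend to zero, hence so does \<open>S k / k\<close>, and every
  squared step equals one.\<close>

lemma AE_superdiffusive_path:
  assumes p: "3/4 < p" "p < 1"
    and lim: "AE \<omega> in M. (\<lambda>n. scaled n \<omega>) \<longlonglongrightarrow> L \<omega>"
    and m: "\<And>n. 1 \<le> m n" "filterlim m at_top sequentially" "\<forall>\<^sub>F n in sequentially. m n \<le> n"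
      "(\<lambda>n. real (m n) / sqrt (total_weight n)) \<longlonglongrightarrow> 0"
  shows "AE \<omega> in M. L \<omega> \<noteq> 0 \<longrightarrow>
    superdiffusive_path (2 * p - 1) m (\<lambda>k. scaled k \<omega>) (\<lambda>k. \<epsilon> k \<omega>) (L \<omega>)"
  using lim AE_bounds
proof eventually_elim
  case (elim \<omega>)
  define y where "y k = S k \<omega> / real k" for k
  have y: "\<forall>\<^sub>F k in sequentially. scaled k \<omega> * weight k = y k"
    using eventually_ge_at_top[of 1] unfolding y_def by eventually_elim (rule scaled_weight)
  have "(\<lambda>k. weight k) \<longlonglongrightarrow> 0"
    by (rule tendsto_neg_powr) (use p in \<open>auto intro: filterlim_real_sequentially\<close>)
  from tendsto_mult[OF elim(1) this] have "(\<lambda>k. scaled k \<omega> * weight k) \<longlonglongrightarrow> 0" by simp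
  then have y0: "y \<longlonglongrightarrow> 0" by (rule Lim_transform_eventually[OF _ y])
  have "(\<lambda>k. (\<epsilon> k \<omega>)\<^sup>2 - 1) \<longlonglongrightarrow> 0"
  proof (rule tendsto_rabs_zero_cancel, rule tendsto_sandwich[OF _ _ tendsto_const])
    \<comment> \<open>With \<open>a = 2 * p - 1\<close>, the difference
      \<open>\<epsilon>\<^sup>2 - 1\<close> factors as \<open>a * y * (a * y - 2 * X)\<close>, where
      X has modulus one; this is the source of the majorant.\<close>
    show "(\<lambda>k. \<bar>(2 * p - 1) * y k\<bar> * (2 + \<bar>(2 * p - 1) * y k\<bar>)) \<longlonglongrightarrow> 0"
      using y0 by (auto intro!: tendsto_eq_intros)
    show "\<forall>\<^sub>F k in sequentially. \<bar>(\<epsilon> k \<omega>)\<^sup>2 - 1\<bar> \<le> \<bar>(2 * p - 1) * y k\<bar> * (2 + \<bar>(2 * p - 1) * y k\<bar>)"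
      using eventually_ge_at_top[of 1]
    proof eventually_elim
      fix k :: nat assume "1 \<le> k"
      have X: "\<bar>X (Suc k) \<omega>\<bar> = 1" using elim(2) by simp
      have "(X (Suc k) \<omega>)\<^sup>2 = 1" using X by (metis power2_abs power_one)
      then have "(\<epsilon> k \<omega>)\<^sup>2 - 1 = (2 * p - 1) * y k * ((2 * p - 1) * y k - 2 * X (Suc k) \<omega>)"
        unfolding \<epsilon>_def y_def[symmetric] by (simp add: power2_eq_square algebra_simps)
      then have "\<bar>(\<epsilon> k \<omega>)\<^sup>2 - 1\<bar> = \<bar>(2 * p - 1) * y k\<bar> * \<bar>(2 * p - 1) * y k - 2 * X (Suc k) \<omega>\<bar>"
        by (simp only: abs_mult)
      also have "\<dots> \<le> \<bar>(2 * p - 1) * y k\<bar> * (2 + \<bar>(2 * p - 1) * y k\<bar>)"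
        using X by (intro mult_left_mono) linarith+
      finally show "\<bar>(\<epsilon> k \<omega>)\<^sup>2 - 1\<bar> \<le> \<bar>(2 * p - 1) * y k\<bar> * (2 + \<bar>(2 * p - 1) * y k\<bar>)" .
    qed
  qed simp
  then have e: "(\<lambda>k. (\<epsilon> k \<omega>)\<^sup>2) \<longlonglongrightarrow> 1" by (simp add: LIM_zero_iff)
  show ?case
  proof (rule impI, unfold_locales)
    show "\<bar>scaled k \<omega> * weight k\<bar> \<le> 1" if "1 \<le> k" for k
      unfolding scaled_weight[OF that] using elim(2) that by blast
  qed (use p m elim e in auto)
qed

text \<open>For \<open>k \<ge> m n\<close> this depends on the first \<open>k\<close> steps only, so
  it is a predictable coefficient. If \<open>scaled (m n)\<close> vanishes, the quotient is 0 and so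
  is the coefficient; the bounds therefore hold on every path.\<close>

definition coeff :: "(nat \<Rightarrow> nat) \<Rightarrow> real \<Rightarrow> nat \<Rightarrow> nat \<Rightarrow> 'a \<Rightarrow> real" where
  "coeff m t n k \<omega> = t * clamp2 (scaled k \<omega> / \<bar>scaled (m n) \<omega>\<bar>) * weight k / sqrt (total_weight n)"

definition frozen_sum :: "(nat \<Rightarrow> nat) \<Rightarrow> nat \<Rightarrow> 'a \<Rightarrow> real" where
  "frozen_sum m n \<omega> = (\<Sum>k=m n..<n. coeff m 1 n k \<omega> * \<epsilon> k \<omega>)"

definition self_normalized :: "nat \<Rightarrow> 'a \<Rightarrow> real" where
  "self_normalized n \<omega> = (\<Sum>k=1..<n. S k \<omega> / real k * \<epsilon> k \<omega>) / sqrt (\<Sum>k=1..<n. (S k \<omega> / real k)\<^sup>2)"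

section \<open>Measurability and size of the coefficients\<close>

lemma coeff_history: "m n \<le> k \<Longrightarrow> coeff m t n k \<in> borel_measurable (history k)"
proof -
  assume "m n \<le> k"
  then have [measurable]: "scaled k \<in> borel_measurable (history k)" "scaled (m n) \<in> borel_measurable (history k)"
    by (auto intro: scaled_history)
  show ?thesis unfolding coeff_def[abs_def] clamp2_def by measurable
qed

lemma coeff_borel [measurable]: "coeff m t n k \<in> borel_measurable M"
  unfolding coeff_def[abs_def] clamp2_def by measurable

lemma frozen_sum_borel [measurable]: "frozen_sum m n \<in> borel_measurable M"
  unfolding frozen_sum_def[abs_def] by measurable

lemma self_normalized_borel [measurable]: "self_normalized n \<in> borel_measurable M"
  unfolding self_normalized_def[abs_def] by measurable

lemma abs_coeff_le: "\<bar>coeff m t n k \<omega>\<bar> \<le> 2 * \<bar>t\<bar> * weight k / sqrt (total_weight n)"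
proof -
  have "\<bar>coeff m t n k \<omega>\<bar> = \<bar>t\<bar> * \<bar>clamp2 (scaled k \<omega> / \<bar>scaled (m n) \<omega>\<bar>)\<bar> * weight k / sqrt (total_weight n)"
    by (simp add: coeff_def abs_mult abs_divide weight_sum_nonneg)
  also have "\<dots> \<le> \<bar>t\<bar> * 2 * weight k / sqrt (total_weight n)"
    by (intro divide_right_mono mult_right_mono mult_left_mono abs_clamp2_le) (auto simp: weight_sum_nonneg)
  finally show ?thesis by (simp only: mult_ac)
qed

text \<open>Dividing by the total weight makes the bound independent of \<open>n\<close>; it
  controls both the second moment of \<open>frozen_sum\<close> and the modulus of McLeish's
  product.\<close>

lemma sum_coeff_bound_sq:
  assumes "1 \<le> m"
  shows "(\<Sum>k=m..<n. (2 * \<bar>t\<bar> * weight k / sqrt (total_weight n))\<^sup>2) \<le> 4 * t\<^sup>2"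
proof -
  have "(\<Sum>k=m..<n. (2 * \<bar>t\<bar> * weight k / sqrt (total_weight n))\<^sup>2) = 4 * t\<^sup>2 * ((\<Sum>k=m..<n. (weight k)\<^sup>2) / total_weight n)"
    by (simp add: sum_distrib_left sum_divide_distrib power_divide power_mult_distrib weight_sum_nonneg)
  also have "(\<Sum>k=m..<n. (weight k)\<^sup>2) \<le> total_weight n"
    unfolding weight_sum_def by (rule sum_mono2) (use assms in auto)
  then have "(\<Sum>k=m..<n. (weight k)\<^sup>2) / total_weight n \<le> 1"
    using weight_sum_nonneg[of "2 * p - 1" n] by (simp add: divide_le_eq)
  then have "4 * t\<^sup>2 * ((\<Sum>k=m..<n. (weight k)\<^sup>2) / total_weight n) \<le> 4 * t\<^sup>2 * 1"
    by (intro mult_left_mono) auto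
  finally show ?thesis by simp
qed

text \<open>The squared coefficient bounds sum to at most \<open>4 * t\<^sup>2\<close>, the squared
  innovations contribute another factor 4, and half of this is the exponent. The bound is free of
  \<open>n\<close>, so it can serve in dominated convergence.\<close>

lemma AE_McLeish_product_le:
  assumes m: "\<And>n. 1 \<le> m n"
  shows "AE \<omega> in M. cmod (\<Prod>k=m n..<n. 1 + \<i> * complex_of_real (coeff m t n k \<omega> * \<epsilon> k \<omega>)) \<le> exp (8 * t\<^sup>2)"
  using AE_bounds
proof eventually_elim
  case (elim \<omega>)
  have "(\<Sum>k=m n..<n. (coeff m t n k \<omega> * \<epsilon> k \<omega>)\<^sup>2) \<le> (\<Sum>k=m n..<n. (2 * \<bar>t\<bar> * weight k / sqrt (total_weight n))\<^sup>2 * 4)"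
  proof (rule sum_mono)
    fix k assume "k \<in> {m n..<n}"
    then have "\<bar>\<epsilon> k \<omega>\<bar> \<le> 2" using elim m[of n] by simp
    then have "\<bar>coeff m t n k \<omega> * \<epsilon> k \<omega>\<bar> \<le> 2 * \<bar>t\<bar> * weight k / sqrt (total_weight n) * 2"
      unfolding abs_mult by (intro mult_mono abs_coeff_le) (auto simp: weight_sum_nonneg)
    then have "\<bar>coeff m t n k \<omega> * \<epsilon> k \<omega>\<bar>\<^sup>2 \<le> (2 * \<bar>t\<bar> * weight k / sqrt (total_weight n) * 2)\<^sup>2"
      by (intro power_mono) auto
    then show "(coeff m t n k \<omega> * \<epsilon> k \<omega>)\<^sup>2 \<le> (2 * \<bar>t\<bar> * weight k / sqrt (total_weight n))\<^sup>2 * 4"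
      unfolding power2_abs power_mult_distrib[of _ "2::real"] by simp
  qed
  also have "\<dots> \<le> 4 * t\<^sup>2 * 4"
    unfolding sum_distrib_right[symmetric] by (intro mult_right_mono sum_coeff_bound_sq m) auto
  finally have "exp ((\<Sum>k=m n..<n. (coeff m t n k \<omega> * \<epsilon> k \<omega>)\<^sup>2) / 2) \<le> exp (8 * t\<^sup>2)" by simp
  with cmod_prod_1_plus_ii_le show ?case by (rule order_trans)
qed

lemma frozen_sum_char_limit:
  fixes g :: "real \<Rightarrow> real"
  assumes p: "3/4 < p" "p < 1"
    and L [measurable]: "L \<in> borel_measurable M"
    and lim: "AE \<omega> in M. (\<lambda>n. scaled n \<omega>) \<longlonglongrightarrow> L \<omega>"
    and m: "\<And>n. 1 \<le> m n" "filterlim m at_top sequentially" "\<forall>\<^sub>F n in sequentially. m n \<le> n"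
      "(\<lambda>n. real (m n) / sqrt (total_weight n)) \<longlonglongrightarrow> 0"
    and g: "continuous_on UNIV g" "\<And>x. 0 \<le> g x" "\<And>x. g x \<le> 1" "g 0 = 0"
  shows "(\<lambda>n. \<integral>\<omega>. g (L \<omega>) * iexp (t * frozen_sum m n \<omega>) \<partial>M)
    \<longlonglongrightarrow> complex_of_real (exp (- t\<^sup>2 / 2) * (\<integral>\<omega>. g (L \<omega>) \<partial>M))"
proof -
  have [measurable]: "g \<in> borel_measurable borel" using g(1) by (rule borel_measurable_continuous_onI)
  \<comment> \<open>The value \<open>g (L \<omega>)\<close> is in general not determined by the
    first \<open>m n\<close> steps; \<open>Z n\<close> is, and converges to it almost
    surely.\<close>
  define Z where "Z n \<omega> = g (scaled (m n) \<omega>)" for n \<omega>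
  define T where "T n \<omega> = (\<Prod>k=m n..<n. 1 + \<i> * complex_of_real (coeff m t n k \<omega> * \<epsilon> k \<omega>))" for n \<omega>
  have [measurable]: "Z n \<in> borel_measurable M" "T n \<in> borel_measurable M" for n
    unfolding Z_def[abs_def] T_def[abs_def] by measurable
  have Zb: "0 \<le> Z n \<omega>" "Z n \<omega> \<le> 1" for n \<omega> by (auto simp: Z_def g)
  have Tb: "AE \<omega> in M. cmod (T n \<omega>) \<le> exp (8 * t\<^sup>2)" for n
    unfolding T_def by (rule AE_McLeish_product_le[OF m(1)])
  have Tb_all: "AE \<omega> in M. \<forall>n. cmod (T n \<omega>) \<le> exp (8 * t\<^sup>2)"
    unfolding AE_all_countable using Tb by blast
  have Zlim: "AE \<omega> in M. (\<lambda>n. Z n \<omega>) \<longlonglongrightarrow> g (L \<omega>)"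
    using lim
  proof eventually_elim
    case (elim \<omega>)
    have "(\<lambda>n. scaled (m n) \<omega>) \<longlonglongrightarrow> L \<omega>" by (rule filterlim_compose[OF elim m(2)])
    then show ?case unfolding Z_def
      by (rule continuous_on_tendsto_compose[OF g(1)]) auto
  qed
  define G where "G n \<omega> = Z n \<omega> * (iexp (t * frozen_sum m n \<omega>) * exp (t\<^sup>2 / 2) - T n \<omega>)" for n \<omega>
  have G0: "(\<lambda>n. \<integral>\<omega>. G n \<omega> \<partial>M) \<longlonglongrightarrow> (\<integral>\<omega>. 0 \<partial>M)"
  proof (rule integral_dominated_convergence[where w="\<lambda>_. exp (t\<^sup>2 / 2) + exp (8 * t\<^sup>2)"])
    show "AE \<omega> in M. norm (G n \<omega>) \<le> exp (t\<^sup>2 / 2) + exp (8 * t\<^sup>2)" for n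
      using Tb[of n]
    proof eventually_elim
      case (elim \<omega>)
      have "cmod (iexp (t * frozen_sum m n \<omega>) * exp (t\<^sup>2 / 2) - T n \<omega>)
          \<le> cmod (iexp (t * frozen_sum m n \<omega>) * exp (t\<^sup>2 / 2)) + cmod (T n \<omega>)"
        by (rule norm_triangle_ineq4)
      also have "cmod (iexp (t * frozen_sum m n \<omega>) * exp (t\<^sup>2 / 2)) = exp (t\<^sup>2 / 2)"
        by (simp add: norm_mult)
      finally have "cmod (iexp (t * frozen_sum m n \<omega>) * exp (t\<^sup>2 / 2) - T n \<omega>) \<le> exp (t\<^sup>2 / 2) + exp (8 * t\<^sup>2)"
        using elim by simp
      then have "Z n \<omega> * cmod (iexp (t * frozen_sum m n \<omega>) * exp (t\<^sup>2 / 2) - T n \<omega>) \<le> 1 * (exp (t\<^sup>2 / 2) + exp (8 * t\<^sup>2))"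
        using Zb by (intro mult_mono) auto
      then show ?case using Zb unfolding G_def norm_mult norm_of_real by simp
    qed
    show "AE \<omega> in M. (\<lambda>n. G n \<omega>) \<longlonglongrightarrow> 0"
      using AE_superdiffusive_path[OF p lim m] Zlim Tb_all
    proof eventually_elim
      case (elim \<omega>)
      show ?case
      proof (cases "L \<omega> = 0")
        case True
        \<comment> \<open>On such paths \<open>Z n\<close> tends to \<open>g 0 = 0\<close> while the
          other factor stays bounded.\<close>
        show ?thesis
        proof (rule Lim_null_comparison)
          show "(\<lambda>n. Z n \<omega> * (exp (t\<^sup>2 / 2) + exp (8 * t\<^sup>2))) \<longlonglongrightarrow> 0"
            using tendsto_mult_left_zero[of "\<lambda>n. Z n \<omega>"] elim(2) True g(4) by simp
          show "\<forall>\<^sub>F n in sequentially. norm (G n \<omega>) \<le> Z n \<omega> * (exp (t\<^sup>2 / 2) + exp (8 * t\<^sup>2))"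
          proof (rule always_eventually, rule allI)
            fix n
            have "cmod (iexp (t * frozen_sum m n \<omega>) * exp (t\<^sup>2 / 2) - T n \<omega>)
                \<le> cmod (iexp (t * frozen_sum m n \<omega>) * exp (t\<^sup>2 / 2)) + cmod (T n \<omega>)"
              by (rule norm_triangle_ineq4)
            also have "cmod (iexp (t * frozen_sum m n \<omega>) * exp (t\<^sup>2 / 2)) = exp (t\<^sup>2 / 2)"
              by (simp add: norm_mult)
            finally have "cmod (iexp (t * frozen_sum m n \<omega>) * exp (t\<^sup>2 / 2) - T n \<omega>) \<le> exp (t\<^sup>2 / 2) + exp (8 * t\<^sup>2)"
              using elim(3)[rule_format, of n] by linarith
            then show "norm (G n \<omega>) \<le> Z n \<omega> * (exp (t\<^sup>2 / 2) + exp (8 * t\<^sup>2))"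
              unfolding G_def norm_mult norm_of_real abs_of_nonneg[OF Zb(1)]
              by (rule mult_left_mono[OF _ Zb(1)])
          qed
        qed
      next
        case False
        then interpret P: superdiffusive_path "2 * p - 1" m "\<lambda>k. scaled k \<omega>" "\<lambda>k. \<epsilon> k \<omega>" "L \<omega>"
          using elim by simp
        have N: "P.N n = frozen_sum m n \<omega>" for n
          unfolding P.N_def frozen_sum_def coeff_def by simp
        have "(\<lambda>n. Z n \<omega> * (iexp (t * frozen_sum m n \<omega>) * exp (t\<^sup>2 / 2) - T n \<omega>)) \<longlonglongrightarrow> complex_of_real (g (L \<omega>)) * 0"
          unfolding T_def coeff_def N[symmetric]
          by (intro tendsto_mult tendsto_of_real elim P.McLeish_remainder)
        then show ?thesis unfolding G_def by simp
      qed
    qed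
  qed (auto simp: G_def[abs_def])
  have int_iexp: "integrable M (\<lambda>\<omega>. f \<omega> * iexp (t * frozen_sum m n \<omega>))"
    if "f \<in> borel_measurable M" "\<And>\<omega>. \<bar>f \<omega>\<bar> \<le> 1" for f :: "'a \<Rightarrow> real" and n
    by (rule integrable_const_bound[of _ 1]) (use that in \<open>auto simp: norm_mult\<close>)
  have int_ZT: "integrable M (\<lambda>\<omega>. Z n \<omega> * T n \<omega>)" for n
  proof (rule integrable_const_bound[of _ "1 * exp (8 * t\<^sup>2)"])
    show "AE \<omega> in M. cmod (Z n \<omega> * T n \<omega>) \<le> 1 * exp (8 * t\<^sup>2)"
      using Tb[of n] unfolding norm_mult
      by eventually_elim (use Zb in \<open>intro mult_mono, auto\<close>)
  qed simp
  have Gint: "(\<integral>\<omega>. G n \<omega> \<partial>M) = exp (t\<^sup>2 / 2) * (\<integral>\<omega>. Z n \<omega> * iexp (t * frozen_sum m n \<omega>) \<partial>M) - complex_of_real (\<integral>\<omega>. Z n \<omega> \<partial>M)"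
    if n: "m n \<le> n" for n
  proof -
    have "(\<integral>\<omega>. G n \<omega> \<partial>M) = (\<integral>\<omega>. exp (t\<^sup>2 / 2) * (Z n \<omega> * iexp (t * frozen_sum m n \<omega>)) - Z n \<omega> * T n \<omega> \<partial>M)"
      by (rule Bochner_Integration.integral_cong) (simp_all add: G_def algebra_simps)
    also have "\<dots> = (\<integral>\<omega>. exp (t\<^sup>2 / 2) * (Z n \<omega> * iexp (t * frozen_sum m n \<omega>)) \<partial>M) - (\<integral>\<omega>. Z n \<omega> * T n \<omega> \<partial>M)"
      by (rule Bochner_Integration.integral_diff[OF integrable_mult_right int_ZT])
         (rule int_iexp, use Zb in auto)
    also have "(\<integral>\<omega>. Z n \<omega> * T n \<omega> \<partial>M) = complex_of_real (\<integral>\<omega>. Z n \<omega> \<partial>M)"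
      unfolding T_def
    proof (rule expectation_McLeish_product[OF m(1) n])
      show "Z n \<in> borel_measurable (history (m n))"
        unfolding Z_def[abs_def] using scaled_history[OF order_refl] by measurable
      show "\<bar>coeff m t n k \<omega>\<bar> \<le> 2 * \<bar>t\<bar> / sqrt (total_weight n)" if "m n \<le> k" for k \<omega>
      proof -
        have "weight k \<le> 1" using weight_le_1[of "2 * p - 1" k] p that m(1)[of n] by simp
        then have "2 * \<bar>t\<bar> * weight k / sqrt (total_weight n) \<le> 2 * \<bar>t\<bar> * 1 / sqrt (total_weight n)"
          by (intro divide_right_mono mult_left_mono) (auto simp: weight_sum_nonneg)
        with abs_coeff_le[of m t n k \<omega>] show ?thesis by simp
      qed
    qed (use Zb in \<open>auto intro: coeff_history\<close>)
    finally show ?thesis by simp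
  qed
  have EZ: "(\<lambda>n. \<integral>\<omega>. Z n \<omega> \<partial>M) \<longlonglongrightarrow> (\<integral>\<omega>. g (L \<omega>) \<partial>M)"
    by (rule integral_dominated_convergence[where w="\<lambda>_. 1"]) (use Zlim Zb in auto)
  have "(\<lambda>n. exp (t\<^sup>2 / 2) * (\<integral>\<omega>. Z n \<omega> * iexp (t * frozen_sum m n \<omega>) \<partial>M) - complex_of_real (\<integral>\<omega>. Z n \<omega> \<partial>M)) \<longlonglongrightarrow> 0"
    using G0[simplified] by (rule Lim_transform_eventually) (rule eventually_mono[OF m(3) Gint])
  from tendsto_add[OF this tendsto_of_real[OF EZ]]
  have "(\<lambda>n. exp (t\<^sup>2 / 2) * (\<integral>\<omega>. Z n \<omega> * iexp (t * frozen_sum m n \<omega>) \<partial>M)) \<longlonglongrightarrow> complex_of_real (\<integral>\<omega>. g (L \<omega>) \<partial>M)"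
    by simp
  from tendsto_mult_left[OF this, of "complex_of_real (exp (- t\<^sup>2 / 2))"]
  have EZN: "(\<lambda>n. \<integral>\<omega>. Z n \<omega> * iexp (t * frozen_sum m n \<omega>) \<partial>M) \<longlonglongrightarrow> complex_of_real (exp (- t\<^sup>2 / 2) * (\<integral>\<omega>. g (L \<omega>) \<partial>M))"
    by (simp add: mult.assoc[symmetric] flip: exp_add of_real_mult)
  \<comment> \<open>Now \<open>Z n\<close> is exchanged for \<open>g (L \<omega>)\<close>; the
    oscillating factor has modulus one, so only their distance matters.\<close>
  have "(\<lambda>n. \<integral>\<omega>. (g (L \<omega>) - Z n \<omega>) * iexp (t * frozen_sum m n \<omega>) \<partial>M) \<longlonglongrightarrow> (\<integral>\<omega>. 0 \<partial>M)"
  proof (rule integral_dominated_convergence[where w="\<lambda>_. 1"])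
    show "AE \<omega> in M. (\<lambda>n. (g (L \<omega>) - Z n \<omega>) * iexp (t * frozen_sum m n \<omega>)) \<longlonglongrightarrow> 0"
      using Zlim
    proof eventually_elim
      case (elim \<omega>)
      from tendsto_diff[OF tendsto_const[of "g (L \<omega>)"] elim] have "(\<lambda>n. g (L \<omega>) - Z n \<omega>) \<longlonglongrightarrow> 0" by simp
      then have "(\<lambda>n. \<bar>g (L \<omega>) - Z n \<omega>\<bar>) \<longlonglongrightarrow> 0" by (rule tendsto_rabs_zero)
      then show ?case by (rule Lim_null_comparison[rotated]) (simp add: norm_mult flip: of_real_diff)
    qed
    have "\<bar>g (L \<omega>) - Z n \<omega>\<bar> \<le> 1" for n \<omega>
      using g(2,3)[of "L \<omega>"] Zb[of n \<omega>] by linarith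
    then show "AE \<omega> in M. cmod ((g (L \<omega>) - Z n \<omega>) * iexp (t * frozen_sum m n \<omega>)) \<le> 1" for n
      by (simp add: norm_mult flip: of_real_diff)
  qed auto
  from tendsto_add[OF EZN this]
  have "(\<lambda>n. (\<integral>\<omega>. Z n \<omega> * iexp (t * frozen_sum m n \<omega>) \<partial>M) + (\<integral>\<omega>. (g (L \<omega>) - Z n \<omega>) * iexp (t * frozen_sum m n \<omega>) \<partial>M))
      \<longlonglongrightarrow> complex_of_real (exp (- t\<^sup>2 / 2) * (\<integral>\<omega>. g (L \<omega>) \<partial>M))" by simp
  moreover have "(\<integral>\<omega>. Z n \<omega> * iexp (t * frozen_sum m n \<omega>) \<partial>M) + (\<integral>\<omega>. (g (L \<omega>) - Z n \<omega>) * iexp (t * frozen_sum m n \<omega>) \<partial>M)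
      = (\<integral>\<omega>. g (L \<omega>) * iexp (t * frozen_sum m n \<omega>) \<partial>M)" for n
  proof -
    have "(\<integral>\<omega>. (g (L \<omega>) - Z n \<omega>) * iexp (t * frozen_sum m n \<omega>) \<partial>M)
        = (\<integral>\<omega>. g (L \<omega>) * iexp (t * frozen_sum m n \<omega>) - Z n \<omega> * iexp (t * frozen_sum m n \<omega>) \<partial>M)"
      by (rule Bochner_Integration.integral_cong) (simp_all add: left_diff_distrib)
    also have "\<dots> = (\<integral>\<omega>. g (L \<omega>) * iexp (t * frozen_sum m n \<omega>) \<partial>M) - (\<integral>\<omega>. Z n \<omega> * iexp (t * frozen_sum m n \<omega>) \<partial>M)"
      by (rule Bochner_Integration.integral_diff) (rule int_iexp; use g Zb in \<open>auto simp: abs_of_nonneg\<close>)+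
    finally show ?thesis by simp
  qed
  ultimately show ?thesis by simp
qed

lemma self_normalized_char_limit:
  fixes g :: "real \<Rightarrow> real"
  assumes p: "3/4 < p" "p < 1"
    and L [measurable]: "L \<in> borel_measurable M"
    and lim: "AE \<omega> in M. (\<lambda>n. scaled n \<omega>) \<longlonglongrightarrow> L \<omega>"
    and g: "continuous_on UNIV g" "\<And>x. 0 \<le> g x" "\<And>x. g x \<le> 1" "g 0 = 0"
  shows "(\<lambda>n. \<integral>\<omega>. g (L \<omega>) * iexp (t * self_normalized n \<omega>) \<partial>M)
    \<longlonglongrightarrow> complex_of_real (exp (- t\<^sup>2 / 2) * (\<integral>\<omega>. g (L \<omega>) \<partial>M))"
proof -
  have a: "1/2 < 2 * p - 1" "2 * p - 1 \<le> 1" using p by auto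
  obtain m where m: "\<And>n. 1 \<le> m n" "filterlim m at_top sequentially" "\<forall>\<^sub>F n in sequentially. m n \<le> n"
      "(\<lambda>n. real (m n) / sqrt (total_weight n)) \<longlonglongrightarrow> 0"
    using ex_window[OF a] by blast
  have [measurable]: "g \<in> borel_measurable borel" using g(1) by (rule borel_measurable_continuous_onI)
  define D where "D n \<omega> = sqrt ((\<Sum>k=1..<n. (scaled k \<omega> * weight k)\<^sup>2) / total_weight n)" for n \<omega>
  have [measurable]: "D n \<in> borel_measurable M" for n unfolding D_def[abs_def] by measurable
  have tN: "t * frozen_sum m n \<omega> = (\<Sum>k=m n..<n. coeff m t n k \<omega> * \<epsilon> k \<omega>)" for n \<omega>
    unfolding frozen_sum_def sum_distrib_left by (rule sum.cong) (auto simp: coeff_def)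
  have Slutsky: "(\<lambda>n. \<integral>\<omega>. g (L \<omega>) * cmod (iexp (t * self_normalized n \<omega>) - iexp (t * frozen_sum m n \<omega>)) \<partial>M) \<longlonglongrightarrow> 0"
  \<comment> \<open>Here \<open>\<eta>\<close> is the relative error of the normalizations and
    \<open>\<rho>\<close> collects what is lost before the window and by the clamp. The constant is
    the factor 4 of \<open>martingale_transform_sq_le\<close> times the coefficient bound
    \<open>4 * t\<^sup>2\<close>.\<close>
  proof (rule iexp_Slutsky[where \<eta> = "\<lambda>n \<omega>. \<bar>scaled (m n) \<omega>\<bar> / D n \<omega> - 1" and C = "4 * (4 * t\<^sup>2)"
        and \<rho> = "\<lambda>n \<omega>. t * (self_normalized n \<omega> - frozen_sum m n \<omega> * (\<bar>scaled (m n) \<omega>\<bar> / D n \<omega>))"])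
    show "integrable M (\<lambda>\<omega>. (t * frozen_sum m n \<omega>)\<^sup>2)" for n
      unfolding tN by (rule martingale_transform_sq_le(1)[OF m(1) coeff_history abs_coeff_le])
    show "(\<integral>\<omega>. (t * frozen_sum m n \<omega>)\<^sup>2 \<partial>M) \<le> 4 * (4 * t\<^sup>2)" for n
      unfolding tN
      by (rule order_trans[OF martingale_transform_sq_le(2)[OF m(1) coeff_history abs_coeff_le]])
         (assumption | rule mult_left_mono[OF sum_coeff_bound_sq[OF m(1)]] | simp)+
    show "AE \<omega> in M. g (L \<omega>) \<noteq> 0 \<longrightarrow> (\<lambda>n. \<bar>scaled (m n) \<omega>\<bar> / D n \<omega> - 1) \<longlonglongrightarrow> 0 \<and>
        (\<lambda>n. t * (self_normalized n \<omega> - frozen_sum m n \<omega> * (\<bar>scaled (m n) \<omega>\<bar> / D n \<omega>))) \<longlonglongrightarrow> 0"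
      using AE_superdiffusive_path[OF p lim m]
    proof eventually_elim
      case (elim \<omega>)
      show ?case
      proof
      assume "g (L \<omega>) \<noteq> 0"
      then have "L \<omega> \<noteq> 0" using g(4) by auto
      then interpret P: superdiffusive_path "2 * p - 1" m "\<lambda>k. scaled k \<omega>" "\<lambda>k. \<epsilon> k \<omega>" "L \<omega>"
        using elim by simp
      have N: "P.N n = frozen_sum m n \<omega>" for n
        unfolding P.N_def frozen_sum_def coeff_def by simp
      have D: "P.D n = D n \<omega>" for n unfolding P.D_def D_def ..
      have R: "P.R n = self_normalized n \<omega>" for n
        unfolding P.R_def self_normalized_def 
          by (intro arg_cong2[where f = "(/)"] arg_cong[where f = sqrt] sum.cong refl)
             (subst scaled_weight, simp, rule refl)+
      show "(\<lambda>n. \<bar>scaled (m n) \<omega>\<bar> / D n \<omega> - 1) \<longlonglongrightarrow> 0 \<and>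
        (\<lambda>n. t * (self_normalized n \<omega> - frozen_sum m n \<omega> * (\<bar>scaled (m n) \<omega>\<bar> / D n \<omega>))) \<longlonglongrightarrow> 0"
        using P.ratio_lim tendsto_mult_right_zero[OF P.remainder_lim, of t] unfolding N D R by simp
      qed
    qed
  qed (auto simp: g algebra_simps)
  have int: "integrable M (\<lambda>\<omega>. g (L \<omega>) * iexp (t * f \<omega>))" if "f \<in> borel_measurable M" for f
    by (rule integrable_const_bound[of _ 1]) (use that g in \<open>auto simp: norm_mult\<close>)
  have "(\<lambda>n. (\<integral>\<omega>. g (L \<omega>) * iexp (t * self_normalized n \<omega>) \<partial>M) - (\<integral>\<omega>. g (L \<omega>) * iexp (t * frozen_sum m n \<omega>) \<partial>M)) \<longlonglongrightarrow> 0"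
  proof (rule Lim_null_comparison[OF _ Slutsky], rule always_eventually, rule allI)
    fix n
    have diff: "(\<integral>\<omega>. g (L \<omega>) * iexp (t * self_normalized n \<omega>) \<partial>M) - (\<integral>\<omega>. g (L \<omega>) * iexp (t * frozen_sum m n \<omega>) \<partial>M)
      = (\<integral>\<omega>. g (L \<omega>) * iexp (t * self_normalized n \<omega>) - g (L \<omega>) * iexp (t * frozen_sum m n \<omega>) \<partial>M)"
      by (rule Bochner_Integration.integral_diff[symmetric]) (rule int, simp)+
    have abs: "(\<integral>\<omega>. cmod (g (L \<omega>) * iexp (t * self_normalized n \<omega>) - g (L \<omega>) * iexp (t * frozen_sum m n \<omega>)) \<partial>M)
      = (\<integral>\<omega>. g (L \<omega>) * cmod (iexp (t * self_normalized n \<omega>) - iexp (t * frozen_sum m n \<omega>)) \<partial>M)"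
      by (rule Bochner_Integration.integral_cong) (simp_all add: norm_mult g flip: right_diff_distrib)
    show "cmod ((\<integral>\<omega>. g (L \<omega>) * iexp (t * self_normalized n \<omega>) \<partial>M) - (\<integral>\<omega>. g (L \<omega>) * iexp (t * frozen_sum m n \<omega>) \<partial>M))
      \<le> (\<integral>\<omega>. g (L \<omega>) * cmod (iexp (t * self_normalized n \<omega>) - iexp (t * frozen_sum m n \<omega>)) \<partial>M)"
      unfolding diff abs[symmetric] by (rule integral_norm_bound)
  qed
  from tendsto_add[OF this frozen_sum_char_limit[OF p L lim m g, of t]] show ?thesis by simp
qed

text \<open>The indicator of nonzero \<open>L\<close> is not a continuous function of
  \<open>L\<close>, but continuous functions vanishing at 0 approximate it in L^1. The resulting
  error is uniform in \<open>n\<close> because \<open>iexp\<close> has modulus one.\<close>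

lemma self_normalized_char_limit_indicator:
  assumes p: "3/4 < p" "p < 1"
    and L [measurable]: "L \<in> borel_measurable M"
    and lim: "AE \<omega> in M. (\<lambda>n. scaled n \<omega>) \<longlonglongrightarrow> L \<omega>"
    and A_def: "A = {\<omega> \<in> space M. (L \<omega>)\<^sup>2 > 0}"
  shows "(\<lambda>n. \<integral>\<omega>. indicator A \<omega> * iexp (t * self_normalized n \<omega>) \<partial>M)
    \<longlonglongrightarrow> complex_of_real (exp (- t\<^sup>2 / 2) * prob A)"
proof (rule LIMSEQ_I)
  fix r :: real assume r: "0 < r"
  have A [measurable]: "A \<in> events" unfolding A_def by measurable
  \<comment> \<open>As \<open>j\<close> grows, these functions increase to the indicator of the
    nonzero reals.\<close>
  define g where "g j x = min 1 (real j * \<bar>x\<bar>)" for j x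
  have gc: "continuous_on UNIV (g j)" for j unfolding g_def[abs_def] by (intro continuous_intros)
  have [measurable]: "g j \<in> borel_measurable borel" for j using gc by (rule borel_measurable_continuous_onI)
  have g: "0 \<le> g j x" "g j x \<le> 1" "g j 0 = 0" for j x by (auto simp: g_def)
  define d where "d j = (\<integral>\<omega>. \<bar>indicator A \<omega> - g j (L \<omega>)\<bar> \<partial>M)" for j
  have db: "\<bar>indicator A \<omega> - g j (L \<omega>)\<bar> \<le> 1" for j \<omega>
    using g(1,2)[of j "L \<omega>"] by (auto simp: indicator_def)
  have "d \<longlonglongrightarrow> (\<integral>\<omega>. 0 \<partial>M)"
    unfolding d_def
  proof (rule integral_dominated_convergence[where w="\<lambda>_. 1"])
    show "AE \<omega> in M. (\<lambda>j. \<bar>indicator A \<omega> - g j (L \<omega>)\<bar>) \<longlonglongrightarrow> 0"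
    proof (rule AE_I2)
      fix \<omega> assume \<omega>: "\<omega> \<in> space M"
      have "\<forall>\<^sub>F j in sequentially. \<bar>indicator A \<omega> - g j (L \<omega>)\<bar> = 0"
      proof (cases "L \<omega> = 0")
        case False
        obtain k :: nat where k: "1 / \<bar>L \<omega>\<bar> \<le> real k" using real_arch_simple by blast
        show ?thesis
          using eventually_ge_at_top[of k]
        proof eventually_elim
          case (elim j)
          have "1 / \<bar>L \<omega>\<bar> \<le> real j" using k elim by (simp add: order_trans)
          then have "1 \<le> real j * \<bar>L \<omega>\<bar>" using False by (simp add: field_simps)
          then show ?case using \<omega> False by (simp add: g_def A_def)
        qed
      qed (simp add: g A_def)
      then show "(\<lambda>j. \<bar>indicator A \<omega> - g j (L \<omega>)\<bar>) \<longlonglongrightarrow> 0" by (rule tendsto_eventually)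
    qed
  qed (use db in auto)
  then have "\<forall>\<^sub>F j in sequentially. d j < r / 3"
    using r by (intro order_tendstoD(2)[where y=0]) auto
  then obtain j where j: "d j < r / 3" by (auto simp: eventually_sequentially)
  define E where "E n = (\<integral>\<omega>. indicator A \<omega> * iexp (t * self_normalized n \<omega>) \<partial>M)" for n
  define F where "F n = (\<integral>\<omega>. g j (L \<omega>) * iexp (t * self_normalized n \<omega>) \<partial>M)" for n
  have approx: "cmod ((\<integral>\<omega>. indicator A \<omega> * h \<omega> \<partial>M) - (\<integral>\<omega>. g j (L \<omega>) * h \<omega> \<partial>M)) \<le> d j"
    if [measurable]: "h \<in> borel_measurable M" and h: "\<And>\<omega>. cmod (h \<omega>) \<le> 1" for h :: "'a \<Rightarrow> complex"
  proof -
    have i: "integrable M (\<lambda>\<omega>. f \<omega> * h \<omega>)" if "f \<in> borel_measurable M" "\<And>\<omega>. \<bar>f \<omega>\<bar> \<le> 1" for f :: "'a \<Rightarrow> real"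
      by (rule integrable_const_bound[of _ 1]) (use that h in \<open>auto simp: norm_mult intro!: mult_le_one\<close>)
    have i1: "integrable M (\<lambda>\<omega>. complex_of_real (indicator A \<omega>) * h \<omega>)"
      by (rule i) (auto simp: indicator_def)
    have i2: "integrable M (\<lambda>\<omega>. complex_of_real (g j (L \<omega>)) * h \<omega>)"
      by (rule i) (auto simp: g)
    have "(\<integral>\<omega>. indicator A \<omega> * h \<omega> \<partial>M) = (\<integral>\<omega>. complex_of_real (indicator A \<omega>) * h \<omega> \<partial>M)"
      by (rule Bochner_Integration.integral_cong) (auto simp: indicator_def)
    then have "(\<integral>\<omega>. indicator A \<omega> * h \<omega> \<partial>M) - (\<integral>\<omega>. g j (L \<omega>) * h \<omega> \<partial>M)
        = (\<integral>\<omega>. complex_of_real (indicator A \<omega>) * h \<omega> - g j (L \<omega>) * h \<omega> \<partial>M)"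
      using Bochner_Integration.integral_diff[OF i1 i2] by simp
    also have "cmod \<dots> \<le> (\<integral>\<omega>. cmod (complex_of_real (indicator A \<omega>) * h \<omega> - g j (L \<omega>) * h \<omega>) \<partial>M)"
      by (rule integral_norm_bound)
    also have "\<dots> \<le> d j"
      unfolding d_def
    proof (rule integral_mono)
      show "integrable M (\<lambda>\<omega>. cmod (complex_of_real (indicator A \<omega>) * h \<omega> - g j (L \<omega>) * h \<omega>))"
        using i1 i2 by auto
      show "integrable M (\<lambda>\<omega>. \<bar>indicator A \<omega> - g j (L \<omega>)\<bar>)"
        by (rule integrable_const_bound[of _ 1]) (use db in auto)
      show "cmod (complex_of_real (indicator A \<omega>) * h \<omega> - g j (L \<omega>) * h \<omega>) \<le> \<bar>indicator A \<omega> - g j (L \<omega>)\<bar>" for \<omega>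
        unfolding left_diff_distrib[symmetric] of_real_diff[symmetric] norm_mult norm_of_real
        by (rule mult_left_le[OF h]) simp
    qed
    finally show ?thesis .
  qed
  have EF: "cmod (E n - F n) \<le> d j" for n
    unfolding E_def F_def by (rule approx) auto
  \<comment> \<open>The same estimate with the constant function one compares \<open>prob A\<close>
    with the mean of \<open>g j (L \<omega>)\<close>.\<close>
  have P: "cmod (complex_of_real (prob A) - (\<integral>\<omega>. g j (L \<omega>) \<partial>M)) \<le> d j"
  proof -
    have "(\<integral>\<omega>. indicator A \<omega> * 1 \<partial>M) = (\<integral>\<omega>. complex_of_real (indicator A \<omega>) \<partial>M)"
      by (rule Bochner_Integration.integral_cong) (auto simp: indicator_def)
    then have "(\<integral>\<omega>. indicator A \<omega> * 1 \<partial>M) = complex_of_real (prob A)"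
      by (simp add: integral_complex_of_real)
    then show ?thesis using approx[of "\<lambda>_. 1"] by simp
  qed
  have "F \<longlonglongrightarrow> complex_of_real (exp (- t\<^sup>2 / 2) * (\<integral>\<omega>. g j (L \<omega>) \<partial>M))"
    unfolding F_def by (rule self_normalized_char_limit[OF p L lim gc]) (auto simp: g)
  from LIMSEQ_D[OF this, of "r/3"] r obtain n0 where
    n0: "\<And>n. n \<ge> n0 \<Longrightarrow> cmod (F n - complex_of_real (exp (- t\<^sup>2 / 2) * (\<integral>\<omega>. g j (L \<omega>) \<partial>M))) < r / 3" by auto
  have "cmod (E n - complex_of_real (exp (- t\<^sup>2 / 2) * prob A)) < r" if n: "n \<ge> n0" for n
  proof -
    have "cmod (complex_of_real (exp (- t\<^sup>2 / 2)) * (complex_of_real (prob A) - (\<integral>\<omega>. g j (L \<omega>) \<partial>M))) \<le> 1 * d j"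
      unfolding norm_mult by (rule mult_mono[OF _ P]) auto
    \<comment> \<open>Three errors, each below \<open>r / 3\<close>: replacing the indicator by
      \<open>g j\<close>, passing to the limit for \<open>g j\<close>, and replacing the mean of
      \<open>g j (L \<omega>)\<close> by \<open>prob A\<close>.\<close>
    moreover have eq: "E n - complex_of_real (exp (- t\<^sup>2 / 2) * prob A) = (E n - F n)
        + (F n - complex_of_real (exp (- t\<^sup>2 / 2) * (\<integral>\<omega>. g j (L \<omega>) \<partial>M)))
        - complex_of_real (exp (- t\<^sup>2 / 2)) * (complex_of_real (prob A) - (\<integral>\<omega>. g j (L \<omega>) \<partial>M))"
      by (simp add: algebra_simps)
    ultimately show ?thesis
      unfolding eq using EF[of n] n0[OF n] j norm_triangle_ineq[of "E n - F n" "F n - complex_of_real (exp (- t\<^sup>2 / 2) * (\<integral>\<omega>. g j (L \<omega>) \<partial>M))"]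
        norm_triangle_ineq4[of "(E n - F n) + (F n - complex_of_real (exp (- t\<^sup>2 / 2) * (\<integral>\<omega>. g j (L \<omega>) \<partial>M)))"
          "complex_of_real (exp (- t\<^sup>2 / 2)) * (complex_of_real (prob A) - (\<integral>\<omega>. g j (L \<omega>) \<partial>M))"]
      by linarith
  qed
  then show "\<exists>n0. \<forall>n\<ge>n0. norm ((\<integral>\<omega>. indicator A \<omega> * iexp (t * self_normalized n \<omega>) \<partial>M) - complex_of_real (exp (- t\<^sup>2 / 2) * prob A)) < r"
    unfolding E_def by blast
qed

section \<open>From the estimator to the self-normalized martingale\<close>

text \<open>Splitting each step into innovation and conditional mean turns the numerator of the
  estimator into \<open>P + 2 * p * Q\<close>. Its error is therefore \<open>P / (2 * Q)\<close>,
  while the normalization is \<open>2 * sqrt Q\<close>.\<close>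

lemma AE_statistic_eq_self_normalized:
  assumes n: "2 \<le> n"
  shows "AE \<omega> in M. sqrt (erw_V X n \<omega>) * (erw_estimator X n \<omega> - p) = self_normalized n \<omega>"
  using AE_bounds
proof eventually_elim
  case (elim \<omega>)
  define y where "y k = S k \<omega> / real k" for k
  define Q where "Q = (\<Sum>k=1..<n. (y k)\<^sup>2)"
  define P where "P = (\<Sum>k=1..<n. y k * \<epsilon> k \<omega>)"
  have I: "{1..n - 1} = {1..<n}" using n by auto
  \<comment> \<open>As \<open>n \<ge> 2\<close>, the sum contains the term \<open>k = 1\<close>,
    which equals one and keeps \<open>Q\<close> positive.\<close>
  have "\<bar>y 1\<bar> = 1" using elim by (simp add: y_def erw_position_def)
  then have "(y 1)\<^sup>2 = 1" by (metis power2_abs power_one)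
  moreover have "(y 1)\<^sup>2 \<le> Q" unfolding Q_def using n by (intro member_le_sum) auto
  ultimately have Q: "0 < Q" by simp
  have "(\<Sum>k=1..<n. y k * (X (k + 1) \<omega> + y k)) = (\<Sum>k=1..<n. y k * \<epsilon> k \<omega> + 2 * p * (y k)\<^sup>2)"
  proof (rule sum.cong[OF refl])
    fix k
    have "X (k + 1) \<omega> = \<epsilon> k \<omega> + (2 * p - 1) * y k" by (simp add: \<epsilon>_def y_def)
    then show "y k * (X (k + 1) \<omega> + y k) = y k * \<epsilon> k \<omega> + 2 * p * (y k)\<^sup>2"
      by (simp only:) (simp add: power2_eq_square algebra_simps)
  qed
  also have "\<dots> = P + 2 * p * Q" by (simp add: P_def Q_def sum.distrib sum_distrib_left)
  finally have "erw_estimator X n \<omega> = (P + 2 * p * Q) / (2 * Q)"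
    unfolding erw_estimator_def I by (simp add: y_def Q_def)
  then have est: "erw_estimator X n \<omega> - p = P / (2 * Q)" using Q by (simp add: field_simps)
  have "sqrt (erw_V X n \<omega>) = 2 * sqrt Q"
    unfolding erw_V_def I by (simp add: y_def Q_def real_sqrt_mult)
  then have "sqrt (erw_V X n \<omega>) * (erw_estimator X n \<omega> - p) = P / sqrt Q"
    unfolding est using Q real_sqrt_mult_self[of Q] by (simp add: field_simps)
  then show ?case by (simp add: self_normalized_def P_def Q_def y_def)
qed

end

text \<open>Levy's continuity theorem reduces the claim to characteristic functions under the
  conditional law. The bound \<open>p < 1\<close> is strict because
  \<open>no_normal_limit_at_1\<close> rules out a normal limit at \<open>p = 1\<close>.\<close>

theorem theorem3p8:
  fixes M :: "'a measure" and p q :: real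
    and X \<alpha> :: "nat \<Rightarrow> 'a \<Rightarrow> real" and \<beta> :: "nat \<Rightarrow> 'a \<Rightarrow> nat" and L :: "'a \<Rightarrow> real"
  assumes "elephant_random_walk M p q X \<alpha> \<beta>"
    and "3/4 < p" and "p < 1"
    and "L \<in> borel_measurable M"
    and "AE \<omega> in M. (\<lambda>n. erw_position X n \<omega> / real n powr (2 * p - 1)) \<longlonglongrightarrow> L \<omega>"
  shows "weak_conv_m
    (\<lambda>n. distr (uniform_measure M {\<omega> \<in> space M. (L \<omega>)\<^sup>2 > 0}) borel
      (\<lambda>\<omega>. sqrt (erw_V X n \<omega>) * (erw_estimator X n \<omega> - p)))
    std_normal_distribution"
proof -
  interpret elephant_random_walk M p q X \<alpha> \<beta> by fact
  note [measurable] = assms(4)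
  define A where "A = {\<omega> \<in> space M. (L \<omega>)\<^sup>2 > 0}"
  define T where "T n \<omega> = sqrt (erw_V X n \<omega>) * (erw_estimator X n \<omega> - p)" for n \<omega>
  have [measurable]: "A \<in> events" unfolding A_def by measurable
  have [measurable]: "T n \<in> borel_measurable M" for n
    unfolding T_def[abs_def] erw_V_def erw_estimator_def by simp
  \<comment> \<open>Positive probability makes \<open>uniform_measure M A\<close> a probability
    measure and permits division by \<open>prob A\<close>.\<close>
  have A: "prob A \<noteq> 0" unfolding A_def by (rule prob_limit_nonzero[OF assms(2,4,5)])
  have lim: "AE \<omega> in M. (\<lambda>n. scaled n \<omega>) \<longlonglongrightarrow> L \<omega>" unfolding scaled_def by fact
  interpret U: prob_space "uniform_measure M A"
    by (rule prob_space_uniform_measure) (use A in \<open>auto simp: emeasure_eq_measure\<close>)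
  have "weak_conv_m (\<lambda>n. distr (uniform_measure M A) borel (T n)) std_normal_distribution"
  proof (rule levy_continuity)
    show "real_distribution (distr (uniform_measure M A) borel (T n))" for n
      by (rule U.real_distribution_distr) simp
    show "real_distribution std_normal_distribution" by (rule real_dist_normal_dist)
    fix t
    \<comment> \<open>The statistic is identified with the self-normalized martingale for
      \<open>n \<ge> 2\<close>, which suffices for the limit.\<close>
    have eq: "(\<integral>\<omega>. indicator A \<omega> * iexp (t * T n \<omega>) \<partial>M) = (\<integral>\<omega>. indicator A \<omega> * iexp (t * self_normalized n \<omega>) \<partial>M)"
      if "2 \<le> n" for n
      by (rule integral_cong_AE)
         (use AE_statistic_eq_self_normalized[OF that] in \<open>auto simp: T_def[symmetric] elim!: eventually_mono\<close>)
    have "(\<lambda>n. (\<integral>\<omega>. indicator A \<omega> * iexp (t * self_normalized n \<omega>) \<partial>M) / prob A)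
        \<longlonglongrightarrow> complex_of_real (exp (- t\<^sup>2 / 2) * prob A) / prob A"
    proof (rule tendsto_divide[OF _ tendsto_const])
      show "(\<lambda>n. \<integral>\<omega>. indicator A \<omega> * iexp (t * self_normalized n \<omega>) \<partial>M) \<longlonglongrightarrow> complex_of_real (exp (- t\<^sup>2 / 2) * prob A)"
        by (rule self_normalized_char_limit_indicator[OF assms(2,3,4) lim A_def])
      show "complex_of_real (prob A) \<noteq> 0" using A by simp
    qed
    then have "(\<lambda>n. (\<integral>\<omega>. indicator A \<omega> * iexp (t * self_normalized n \<omega>) \<partial>M) / prob A)
        \<longlonglongrightarrow> char std_normal_distribution t"
      unfolding char_std_normal_distribution using A by simp
    then show "(\<lambda>n. char (distr (uniform_measure M A) borel (T n)) t) \<longlonglongrightarrow> char std_normal_distribution t"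
    proof (rule Lim_transform_eventually)
      show "\<forall>\<^sub>F n in sequentially. (\<integral>\<omega>. indicator A \<omega> * iexp (t * self_normalized n \<omega>) \<partial>M) / prob A
          = char (distr (uniform_measure M A) borel (T n)) t"
        using eventually_ge_at_top[of 2]
        by eventually_elim (simp add: char_distr_uniform_measure A eq del: of_real_mult)
    qed
  qed
  then show ?thesis unfolding A_def T_def .
qed

end
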